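(* The symmetric group $S_3$ generated by $\sigma$ and $\tau$ permutes the three representations $\lambda_8$, $\kappa_8^+$ and $\kappa_8^-$ of $Spin(8)$, i.e. the following identities of homomorphisms $Spin(8)\to SO(8)$ hold: $$\lambda_8\circ\sigma=\kappa_8^-,\qquad \lambda_8\circ\tau=\kappa_8^+,\qquad \kappa_8^-\circ(\tau\circ\sigma)=\kappa_8^+,$$ that is, the diagram formed by $\tau:Spin(8)\to Spin(8)$, $\sigma:Spin(8)\to Spin(8)$, $\tau\sigma:Spin(8)\to Spin(8)$, and $\lambda_8,\kappa_8^+,\kappa_8^-:Spin(8)\to SO(8)$ commutes.
   Context: $Cl_8$ is the real Clifford algebra generated by the standard basis vectors $e_1,\dots,e_8$ of $\mathbb{R}^8$ with $e_je_k=-e_ke_j$ for $j\ne k$ and $e_j^2=-1$. $Spin(8)\subset Cl_8$ is the group of all products $x_1x_2\cdots x_{2l}$ of an even number of unit vectors $x_j\in\mathbb{R}^8$; its Lie algebra $\mathfrak{spin}(8)\subset Cl_8$ is the real span of $e_ie_j$, $1\le i<j\le 8$. $Spin(8)$ is simply connected. $\lambda_8:Spin(8)\to SO(8)$ is the double covering homomorphism sending $x_1\cdots x_{2l}$ to the transformation $y\mapsto x_1\cdots x_{2l}\,y\,x_{2l}\cdots x_1$ of $\mathbb{R}^8$. Spinors: $\Delta_8$ is the 16-dimensional complex vector space with unitary basis $u_0,\dots,u_{15}$. For $0\le a\le 15$ write $a=a_0+2a_1+4a_2+8a_3$ with $a_l\in\{0,1\}$. The vectors of $\mathbb{R}^8$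 act on $\Delta_8$ by Clifford multiplication: for $1\le j\le 4$, $$e_{2j-1}u_a=i(-1)^{j-1}(-1)^{a_0+\cdots+a_{j-2}}u_{a+(-1)^{a_{j-1}}2^{j-1}},\qquad e_{2j}u_a=(-1)^{j-1}(-1)^{a_0+\cdots+a_{j-1}}u_{a+(-1)^{a_{j-1}}2^{j-1}},$$ which makes $\Delta_8$ a $Cl_8$-module. $\tilde\Delta_8^+\subset\Delta_8$ is the real span of the ordered basis ($\frac{1}{\sqrt2}$ times) $$u_0-u_{15},\ i(u_0+u_{15}),\ u_3+u_{12},\ -i(u_3-u_{12}),\ -(u_5-u_{10}),\ i(u_5+u_{10}),\ u_6+u_9,\ i(u_6-u_9),$$ and $\tilde\Delta_8^-\subset\Delta_8$ is the real span of the ordered basis obtained by applying $e_1$ to these, namely ($\frac1{\sqrt2}$ times) $$i(u_1-u_{14}),\ -(u_1+u_{14}),\ i(u_2+u_{13}),\ u_2-u_{13},\ -i(u_4-u_{11}),\ -(u_4+u_{11}),\ i(u_7+u_8),\ -(u_7-u_8).$$ Both spaces are preserved by $Spin(8)$, and $\kappa_8^\pm:Spin(8)\to SO(8)$ denotes the action of $Spin(8)$ on $\tilde\Delta_8^\pm$, where $\tilde\Delta_8^+$ is identified with $\mathbb{R}^8$ by sending the ordered orthonormal basis $\frac1{\sqrt2}(u_0-u_{15}),\ \frac{i}{\sqrt2}(u_0+u_{15}),\ \frac1{\sqrt2}(u_3+u_{12}),\ -\frac{i}{\sqrt2}(u_3-u_{12}),\ -\frac1{\sqrt2}(u_5-u_{10}),\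 \frac{i}{\sqrt2}(u_5+u_{10}),\ \frac1{\sqrt2}(u_6+u_9),\ \frac{i}{\sqrt2}(u_6-u_9)$ to $(e_1,\dots,e_8)$, and $\tilde\Delta_8^-$ is identified with $\mathbb{R}^8$ by sending the ordered orthonormal basis $\frac{i}{\sqrt2}(u_1-u_{14}),\ -\frac1{\sqrt2}(u_1+u_{14}),\ \frac{i}{\sqrt2}(u_2+u_{13}),\ \frac1{\sqrt2}(u_2-u_{13}),\ -\frac{i}{\sqrt2}(u_4-u_{11}),\ -\frac1{\sqrt2}(u_4+u_{11}),\ \frac{i}{\sqrt2}(u_7+u_8),\ -\frac1{\sqrt2}(u_7-u_8)$ to $(e_1,\dots,e_8)$. $\sigma:Spin(8)\to Spin(8)$ is the homomorphism lifting $\kappa_8^-$ through the covering $\lambda_8$, and $\tau:Spin(8)\to Spin(8)$ is the homomorphism lifting $\kappa_8^+$ through $\lambda_8$ (these lifts exist and are unique since $Spin(8)$ is simply connected). *)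

theory Defs
  imports "HOL-Analysis.Analysis" "HOL-Algebra.Bij" "HOL-Algebra.Sym_Groups"
begin

(* Coordinates are numbered 1, ..., 8 through of_nat, so the eighth coordinate has index
   0 = 8 of the numeral type 8.  Orderings always refer to the labels 1, ..., 8 in nat,
   never to the type 8. *)

definition labels :: "8 set \<Rightarrow> nat set" where
  "labels A = {j \<in> {1..8}. of_nat j \<in> A}"

(* The Clifford algebra has the basis e_A = e_(j1) ... e_(jk), A = {j1 < ... < jk}.
   Sorting the word e_A e_B contributes one sign for every j in A, k in B with k < j, and
   each j in both A and B contributes a further sign because e_j e_j = -1. *)

type_synonym cl8 = "(real, 8 set) vec"

definition cl_sign :: "8 set \<Rightarrow> 8 set \<Rightarrow> real" where
  "cl_sign A B = (-1) ^ card {(j, k). j \<in> labels A \<and> k \<in> labels B \<and> k \<le> j}"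

definition cl_basis :: "8 set \<Rightarrow> cl8" where
  "cl_basis A = axis A 1"

definition cl_mult :: "cl8 \<Rightarrow> cl8 \<Rightarrow> cl8"  (infixl \<open>\<star>\<close> 70) where
  "x \<star> y = (\<Sum>A\<in>UNIV. \<Sum>B\<in>UNIV. (x $ A * y $ B * cl_sign A B) *\<^sub>R cl_basis (sym_diff A B))"

definition cl_one :: cl8 where
  "cl_one = cl_basis {}"

definition cl_vec :: "real^8 \<Rightarrow> cl8" where
  "cl_vec x = (\<Sum>i\<in>UNIV. x $ i *\<^sub>R cl_basis {i})"

definition cl_prod :: "(real^8) list \<Rightarrow> cl8" where
  "cl_prod xs = foldr (\<lambda>x c. cl_vec x \<star> c) xs cl_one"

definition unit_word :: "(real^8) list \<Rightarrow> bool" where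
  "unit_word xs \<longleftrightarrow> even (length xs) \<and> (\<forall>x\<in>set xs. norm x = 1)"

definition Spin8 :: "cl8 monoid" where
  "Spin8 = \<lparr>carrier = {cl_prod xs |xs. unit_word xs}, mult = (\<star>), one = cl_one\<rparr>"

definition SO8 :: "(real^8^8) monoid" where
  "SO8 = \<lparr>carrier = {A. rotation_matrix A}, mult = (**), one = mat 1\<rparr>"

definition lambda8 :: "cl8 \<Rightarrow> real^8^8" where
  "lambda8 g = (THE M. \<forall>xs. unit_word xs \<and> g = cl_prod xs \<longrightarrow>
     (\<forall>y. cl_vec (M *v y) = cl_prod xs \<star> cl_vec y \<star> cl_prod (rev xs)))"

type_synonym spinor = "complex^16"

definition uvec :: "nat \<Rightarrow> spinor" where
  "uvec a = axis (of_nat a) 1"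

definition digit :: "nat \<Rightarrow> nat \<Rightarrow> nat" where
  "digit a l = a div 2 ^ l mod 2"

(* dirac_basis j a is e_j u_a.  With m = (j + 1) div 2, the odd labels are j = 2m - 1 and the
   even ones j = 2m; adding (-1)^(a_(m-1)) 2^(m-1) to a flips its binary digit m - 1. *)

definition dirac_basis :: "nat \<Rightarrow> nat \<Rightarrow> spinor" where
  "dirac_basis j a = (let m = (j + 1) div 2 in
     (if odd j then \<i> * (-1) ^ (m - 1) * (-1) ^ (\<Sum>l<m - 1. digit a l)
      else (-1) ^ (m - 1) * (-1) ^ (\<Sum>l<m. digit a l)) *s uvec (flip_bit (m - 1) a))"

definition dirac :: "nat \<Rightarrow> spinor \<Rightarrow> spinor" where
  "dirac j v = (\<Sum>a<16. v $ of_nat a *s dirac_basis j a)"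

definition cl_act :: "cl8 \<Rightarrow> spinor \<Rightarrow> spinor" where
  "cl_act x v = (\<Sum>A\<in>UNIV. x $ A *\<^sub>R foldr dirac (sorted_list_of_set (labels A)) v)"

definition plus_basis :: "spinor list" where
  "plus_basis = map (\<lambda>v. v /\<^sub>R sqrt 2)
     [uvec 0 - uvec 15, \<i> *s (uvec 0 + uvec 15), uvec 3 + uvec 12, - \<i> *s (uvec 3 - uvec 12),
      - (uvec 5 - uvec 10), \<i> *s (uvec 5 + uvec 10), uvec 6 + uvec 9, \<i> *s (uvec 6 - uvec 9)]"

definition minus_basis :: "spinor list" where
  "minus_basis = map (\<lambda>v. v /\<^sub>R sqrt 2)
     [\<i> *s (uvec 1 - uvec 14), - (uvec 1 + uvec 14), \<i> *s (uvec 2 + uvec 13), uvec 2 - uvec 13,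
      - \<i> *s (uvec 4 - uvec 11), - (uvec 4 + uvec 11), \<i> *s (uvec 7 + uvec 8), - (uvec 7 - uvec 8)]"

definition half_spinor :: "spinor list \<Rightarrow> real^8 \<Rightarrow> spinor" where
  "half_spinor bs y = (\<Sum>j=1..8. y $ of_nat j *\<^sub>R (bs ! (j - 1)))"

definition kappa :: "spinor list \<Rightarrow> cl8 \<Rightarrow> real^8^8" where
  "kappa bs g = (THE M. \<forall>y. half_spinor bs (M *v y) = cl_act g (half_spinor bs y))"

definition kappa_plus :: "cl8 \<Rightarrow> real^8^8" where
  "kappa_plus = kappa plus_basis"

definition kappa_minus :: "cl8 \<Rightarrow> real^8^8" where
  "kappa_minus = kappa minus_basis"

(* Extensionality fixes the irrelevant values outside Spin8, so that the lift is unique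
   as a total function. *)

definition spin_lift :: "(cl8 \<Rightarrow> real^8^8) \<Rightarrow> cl8 \<Rightarrow> cl8" where
  "spin_lift k = (THE s. s \<in> extensional (carrier Spin8) \<and> s \<in> hom Spin8 Spin8 \<and>
     continuous_on (carrier Spin8) s \<and> (\<forall>g\<in>carrier Spin8. lambda8 (s g) = k g))"

definition sigma8 :: "cl8 \<Rightarrow> cl8" where
  "sigma8 = spin_lift kappa_minus"

definition tau8 :: "cl8 \<Rightarrow> cl8" where
  "tau8 = spin_lift kappa_plus"

end

theory Submission
  imports Defs
begin

text \<open>
In the given bases the two half-spinor spaces are copies of \<open>\<real>\<^sup>8\<close>, and Clifford multiplication by a vector \<open>x\<close>
maps a positive half-spinor \<open>y\<close> to the negative half-spinor \<open>oct x y\<close>, the product \<open>conj(x) y\<close> of octonions.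
An element \<open>g\<close> of the spin group therefore gives three rotations \<open>A\<close>, \<open>B\<close>, \<open>C\<close>, its images under \<open>lambda8\<close>,
\<open>kappa_plus\<close> and \<open>kappa_minus\<close>, with \<open>C (oct x y) = oct (A x) (B y)\<close> (lemma \<open>triality\<close>).  Write \<open>K\<close> for octonion
conjugation.  Two operations preserve this relation, and each comes from an automorphism of the group.

Conjugation by \<open>e\<^sub>1\<close> (\<open>pin_aut\<close>) turns the triple \<open>(A, B, C)\<close> into \<open>(K A K, C, B)\<close>.  Conjugating the relation itself
turns \<open>(A, B, C)\<close> into \<open>(B, A, K C K)\<close>, because \<open>K (oct x y) = oct y x\<close>.  This triple also belongs to an element
\<open>h\<close>: by the theorem of Cartan and Dieudonne \<open>lambda8\<close> is onto, so \<open>lambda8 h = B\<close> for some \<open>h\<close>, and the first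
component of a triple determines the other two up to a common sign (\<open>triality_determined\<close>), because a map that
commutes with all left multiplications by octonions is a scalar.  Either \<open>h\<close> or \<open>- h\<close> has the required triple, and
only one element has, because the Clifford algebra acts faithfully on spinors (\<open>act_faithful\<close>).  Sending \<open>g\<close> to
this element defines \<open>swap_aut\<close>.

By construction \<open>swap_aut\<close> lifts \<open>kappa_plus\<close> and \<open>swap_aut \<circ> pin_aut\<close> lifts \<open>kappa_minus\<close>.  They are continuous,
because faithfulness recovers an element linearly from its action on spinors, and they are the only lifts
(\<open>spin_lift_eq\<close>): two homomorphic lifts agree up to sign, hence agree on squares, and squares generate the group
because a product of two unit vectors is a square.  So \<open>tau8 = swap_aut\<close> and \<open>sigma8 = swap_aut \<circ> pin_aut\<close>.  The
effect on triples shows that \<open>swap_aut\<close> and \<open>pin_aut\<close> are distinct involutions that satisfy the braid relation;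
they generate a symmetric group on three letters, and the three identities can be read off from the triples.
\<close>

section \<open>The Clifford algebra in its monomial basis\<close>

text \<open>The sign that sorts the word of \<open>S\<close> followed by the word of \<open>T\<close>.  Written as a product over pairs of
letters, instead of a power of \<open>-1\<close>, it is visibly multiplicative in both arguments with respect to symmetric
difference.\<close>

definition inversion_sign :: "nat set \<Rightarrow> nat set \<Rightarrow> real" where
  "inversion_sign S T = (\<Prod>j\<in>S. \<Prod>k\<in>T. if k \<le> j then -1 else 1)"

lemma prod_sym_diff:
  fixes f :: "'a \<Rightarrow> real"
  assumes "finite S" "finite T" "\<And>x. f x * f x = 1"
  shows "prod f (sym_diff S T) = prod f S * prod f T"
proof -
  have S: "prod f S = prod f (S - T) * prod f (S \<inter> T)"
    using assms(1) by (subst prod.union_disjoint [symmetric]) (auto intro!: prod.cong)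
  have T: "prod f T = prod f (T - S) * prod f (S \<inter> T)"
    using assms(2) by (subst prod.union_disjoint [symmetric]) (auto intro!: prod.cong)
  have "prod f (S \<inter> T) * prod f (S \<inter> T) = 1"
    by (simp add: prod.distrib [symmetric] assms(3))
  moreover have "prod f (sym_diff S T) = prod f (S - T) * prod f (T - S)"
    using assms by (subst prod.union_disjoint) auto
  ultimately show ?thesis
    by (simp add: S T mult.assoc mult.left_commute)
qed

lemma inversion_sign_sym_diff_left:
  assumes "finite S" "finite S'"
  shows "inversion_sign (sym_diff S S') T = inversion_sign S T * inversion_sign S' T"
  unfolding inversion_sign_def
  by (rule prod_sym_diff) (auto simp: assms prod.distrib [symmetric] intro!: prod.neutral)

lemma inversion_sign_sym_diff_right:
  assumes "finite T" "finite T'"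
  shows "inversion_sign S (sym_diff T T') = inversion_sign S T * inversion_sign S T'"
  unfolding inversion_sign_def prod.distrib [symmetric]
  by (rule prod.cong [OF refl], rule prod_sym_diff) (auto simp: assms)

lemma inversion_sign_square: "inversion_sign S T * inversion_sign S T = 1"
  unfolding inversion_sign_def by (auto simp: prod.distrib [symmetric] intro!: prod.neutral)

lemma finite_labels [simp]: "finite (labels A)"
  by (simp add: labels_def)

lemma labels_empty [simp]: "labels {} = {}"
  by (simp add: labels_def)

lemma labels_sym_diff: "labels (sym_diff A B) = sym_diff (labels A) (labels B)"
  by (auto simp: labels_def)

lemma cl_sign_eq: "cl_sign A B = inversion_sign (labels A) (labels B)"
proof -
  let ?S = "labels A" and ?T = "labels B"
  have "{(j, k). j \<in> ?S \<and> k \<in> ?T \<and> k \<le> j} = {p \<in> ?S \<times> ?T. snd p \<le> fst p}"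
    by auto
  moreover have "(\<Prod>p\<in>?S \<times> ?T. if snd p \<le> fst p then -1 else 1 :: real)
      = (\<Prod>p\<in>{p \<in> ?S \<times> ?T. snd p \<le> fst p}. -1)"
    by (subst prod.inter_filter) auto
  ultimately show ?thesis
    by (simp add: cl_sign_def inversion_sign_def prod.cartesian_product case_prod_unfold)
qed

lemma cl_sign_empty [simp]: "cl_sign {} A = 1" "cl_sign A {} = 1"
  by (simp_all add: cl_sign_eq inversion_sign_def)

text \<open>Bimultiplicativity turns both sides into the product of the signs of the pairs \<open>(A, B)\<close>, \<open>(A, C)\<close> and
\<open>(B, C)\<close>.  The identity is associativity of the Clifford product on basis elements.\<close>

lemma cl_sign_cocycle:
  "cl_sign A B * cl_sign (sym_diff A B) C = cl_sign B C * cl_sign A (sym_diff B C)"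
  by (simp add: cl_sign_eq labels_sym_diff inversion_sign_sym_diff_left
      inversion_sign_sym_diff_right)

lemma cl_sign_square: "cl_sign A B * cl_sign A B = 1"
  by (simp add: cl_sign_eq inversion_sign_square)

lemma cl_mult_add_left: "(x + y) \<star> z = x \<star> z + y \<star> z"
  by (simp add: cl_mult_def algebra_simps sum.distrib)

lemma cl_mult_add_right: "x \<star> (y + z) = x \<star> y + x \<star> z"
  by (simp add: cl_mult_def algebra_simps sum.distrib)

lemma cl_mult_scaleR_left: "(c *\<^sub>R x) \<star> y = c *\<^sub>R (x \<star> y)"
  by (simp add: cl_mult_def scaleR_sum_right mult.assoc)

lemma cl_mult_scaleR_right: "x \<star> (c *\<^sub>R y) = c *\<^sub>R (x \<star> y)"
  by (simp add: cl_mult_def scaleR_sum_right mult_ac)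

lemmas cl_mult_simps = cl_mult_add_left cl_mult_add_right cl_mult_scaleR_left cl_mult_scaleR_right

lemma linear_cl_mult_left: "linear (\<lambda>x. x \<star> y)"
  by (rule linearI) (simp_all add: cl_mult_add_left cl_mult_scaleR_left)

lemma linear_cl_mult_right: "linear (\<lambda>y. x \<star> y)"
  by (rule linearI) (simp_all add: cl_mult_add_right cl_mult_scaleR_right)

lemma cl_mult_minus [simp]: "(- x) \<star> y = - (x \<star> y)" "x \<star> (- y) = - (x \<star> y)"
  using linear_neg[OF linear_cl_mult_left] linear_neg[OF linear_cl_mult_right] by auto

lemma cl_mult_diff: "(x - y) \<star> z = x \<star> z - y \<star> z" "x \<star> (y - z) = x \<star> y - x \<star> z"
  by (rule linear_diff[OF linear_cl_mult_left], rule linear_diff[OF linear_cl_mult_right])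

lemma cl_mult_basis:
  "cl_basis A \<star> cl_basis B = cl_sign A B *\<^sub>R cl_basis (sym_diff A B)"
proof -
  have "cl_basis A \<star> cl_basis B = (\<Sum>A'\<in>UNIV. if A' = A then
      (\<Sum>B'\<in>UNIV. if B' = B then cl_sign A B *\<^sub>R cl_basis (sym_diff A B) else 0) else 0)"
    unfolding cl_mult_def
  proof (rule sum.cong[OF refl])
    fix A'
    show "(\<Sum>B'\<in>UNIV. (cl_basis A $ A' * cl_basis B $ B' * cl_sign A' B') *\<^sub>R cl_basis (sym_diff A' B'))
      = (if A' = A then
      (\<Sum>B'\<in>UNIV. if B' = B then cl_sign A B *\<^sub>R cl_basis (sym_diff A B) else 0) else 0)"
    proof (cases "A' = A")
      case True
      have "(cl_basis A $ A' * cl_basis B $ B' * cl_sign A' B') *\<^sub>R cl_basis (sym_diff A' B')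
          = (if B' = B then cl_sign A B *\<^sub>R cl_basis (sym_diff A B) else 0)" for B'
        using True by (simp add: cl_basis_def axis_def)
      then show ?thesis
        by (simp only: True if_True simp_thms)
    qed (simp add: cl_basis_def axis_def)
  qed
  then show ?thesis
    by simp
qed

lemma cl_expand: "x = (\<Sum>A\<in>UNIV. x $ A *\<^sub>R cl_basis A)"
proof -
  have "x $ B = (\<Sum>A\<in>UNIV. (x $ A *\<^sub>R cl_basis A) $ B)" for B
    by (simp add: cl_basis_def axis_def if_distrib cong: if_cong)
  then show ?thesis
    unfolding vec_eq_iff sum_component by blast
qed

lemma cl_linear_eqI:
  assumes "linear f" "linear g" "\<And>A. f (cl_basis A) = g (cl_basis A)"
  shows "f x = g x"
proof -
  have "f (\<Sum>A\<in>UNIV. x $ A *\<^sub>R cl_basis A) = g (\<Sum>A\<in>UNIV. x $ A *\<^sub>R cl_basis A)"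
    using assms by (simp add: linear_sum linear_scale)
  then show ?thesis
    using cl_expand[of x] by simp
qed

lemma cl_mult_assoc: "(x \<star> y) \<star> z = x \<star> (y \<star> z)"
proof -
  have b: "(cl_basis A \<star> cl_basis B) \<star> cl_basis C = cl_basis A \<star> (cl_basis B \<star> cl_basis C)" for A B C
  proof -
    have "sym_diff (sym_diff A B) C = sym_diff A (sym_diff B C)"
      by auto
    then show ?thesis
      by (simp add: cl_mult_basis cl_mult_scaleR_left cl_mult_scaleR_right cl_sign_cocycle)
  qed
  have bb: "(cl_basis A \<star> cl_basis B) \<star> z = cl_basis A \<star> (cl_basis B \<star> z)" for A B z
    by (rule cl_linear_eqI[of "\<lambda>z. (cl_basis A \<star> cl_basis B) \<star> z"])
      (simp_all add: linear_iff cl_mult_simps b)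
  have bbb: "(cl_basis A \<star> y) \<star> z = cl_basis A \<star> (y \<star> z)" for A y z
    by (rule cl_linear_eqI[of "\<lambda>y. (cl_basis A \<star> y) \<star> z"])
      (simp_all add: linear_iff cl_mult_simps bb)
  show ?thesis
    by (rule cl_linear_eqI[of "\<lambda>x. (x \<star> y) \<star> z"])
      (simp_all add: linear_iff cl_mult_simps bbb)
qed

lemma cl_one_mult [simp]: "cl_one \<star> x = x"
  by (rule cl_linear_eqI[of "\<lambda>x. cl_one \<star> x"])
    (auto simp: cl_one_def cl_mult_basis linear_cl_mult_right linear_id[unfolded id_def])

lemma cl_mult_one [simp]: "x \<star> cl_one = x"
  by (rule cl_linear_eqI[of "\<lambda>x. x \<star> cl_one"])
    (auto simp: cl_one_def cl_mult_basis linear_cl_mult_left linear_id[unfolded id_def])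

lemma linear_cl_vec: "linear cl_vec"
  by (rule linearI)
    (simp_all add: cl_vec_def algebra_simps sum.distrib scaleR_sum_right)

lemma inj_cl_vec: "inj cl_vec"
proof -
  have "cl_vec x $ {j} = x $ j" for x j
    by (simp add: cl_vec_def cl_basis_def axis_def if_distrib cong: if_cong)
  then show ?thesis
    by (metis injI vec_eq_iff)
qed

lemma label_exists: obtains j where "j \<in> {1..8}" "i = (of_nat j :: 8)"
proof (cases i)
  case (of_int z)
  then have z: "0 \<le> z" "z < 8" "i = of_nat (nat z)" by auto
  show ?thesis
  proof (cases "z = 0")
    case True
    then have "i = of_nat 8" using z by simp
    then show ?thesis by (intro that[of 8]) auto
  next
    case False
    then show ?thesis using z by (intro that[of "nat z"]) auto
  qed
qed

lemma label_unique:
  assumes "j \<in> {1..8}" "k \<in> {1..8}" "(of_nat j :: 8) = of_nat k"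
  shows "j = k"
proof -
  have "j \<in> {1,2,3,4,5,6,7,8}" "k \<in> {1,2,3,4,5,6,7,8}"
    using assms(1,2) by auto
  then show ?thesis
    using assms(3) by (elim insertE emptyE) simp_all
qed

lemma labels_singleton: "j \<in> {1..8} \<Longrightarrow> labels {of_nat j} = {j}"
  unfolding labels_def using label_unique by blast

lemma clifford_relation_basis:
  "cl_basis {i} \<star> cl_basis {j} + cl_basis {j} \<star> cl_basis {i}
    = (if i = j then -2 else 0) *\<^sub>R cl_one"
proof -
  obtain k l where kl: "k \<in> {1..8}" "i = of_nat k" "l \<in> {1..8}" "j = of_nat l"
    by (meson label_exists)
  have s: "cl_sign {i} {j} = (if l \<le> k then -1 else 1)"
    "cl_sign {j} {i} = (if k \<le> l then -1 else 1)"
    using kl by (simp_all add: cl_sign_eq labels_singleton inversion_sign_def)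
  show ?thesis
  proof (cases "i = j")
    case True
    then have "k = l" using kl label_unique by blast
    then show ?thesis using True s by (simp add: cl_mult_basis cl_one_def vec_eq_iff)
  next
    case False
    then have "k \<noteq> l" using kl by auto
    moreover have "sym_diff {i} {j} = sym_diff {j} {i}" by auto
    ultimately show ?thesis using False s by (auto simp: cl_mult_basis)
  qed
qed

lemma clifford_relation:
  "cl_vec x \<star> cl_vec y + cl_vec y \<star> cl_vec x = (- 2 * (x \<bullet> y)) *\<^sub>R cl_one"
proof -
  have expand: "cl_vec x \<star> cl_vec y
      = (\<Sum>i\<in>UNIV. \<Sum>j\<in>UNIV. (x $ i * y $ j) *\<^sub>R (cl_basis {i} \<star> cl_basis {j}))" for x y
    unfolding cl_vec_def linear_sum[OF linear_cl_mult_left] linear_sum[OF linear_cl_mult_right]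
      cl_mult_scaleR_left cl_mult_scaleR_right scaleR_sum_right scaleR_scaleR
    by (subst sum.swap) (simp only: mult.commute)
  have "cl_vec y \<star> cl_vec x
      = (\<Sum>i\<in>UNIV. \<Sum>j\<in>UNIV. (x $ i * y $ j) *\<^sub>R (cl_basis {j} \<star> cl_basis {i}))"
    unfolding expand by (subst sum.swap) (simp only: mult.commute)
  then have "cl_vec x \<star> cl_vec y + cl_vec y \<star> cl_vec x
      = (\<Sum>i\<in>UNIV. \<Sum>j\<in>UNIV. (x $ i * y $ j) *\<^sub>R (cl_basis {i} \<star> cl_basis {j} + cl_basis {j} \<star> cl_basis {i}))"
    unfolding expand by (simp only: sum.distrib scaleR_add_right)
  also have "\<dots> = (\<Sum>i\<in>UNIV. (- 2 * (x $ i * y $ i)) *\<^sub>R cl_one)"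
  proof (rule sum.cong[OF refl])
    fix i
    have "(\<Sum>j\<in>UNIV. (x $ i * y $ j) *\<^sub>R (cl_basis {i} \<star> cl_basis {j} + cl_basis {j} \<star> cl_basis {i}))
       = (\<Sum>j\<in>UNIV. if j = i then (- 2 * (x $ i * y $ i)) *\<^sub>R cl_one else 0)"
      unfolding clifford_relation_basis by (intro sum.cong) auto
    then show "(\<Sum>j\<in>UNIV. (x $ i * y $ j) *\<^sub>R (cl_basis {i} \<star> cl_basis {j} + cl_basis {j} \<star> cl_basis {i}))
       = (- 2 * (x $ i * y $ i)) *\<^sub>R cl_one"
      by simp
  qed
  also have "\<dots> = (- 2 * (x \<bullet> y)) *\<^sub>R cl_one"
    by (simp only: inner_vec_def inner_real_def sum_distrib_left scaleR_left.sum)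
  finally show ?thesis .
qed

lemma cl_vec_square: "cl_vec x \<star> cl_vec x = - (norm x)\<^sup>2 *\<^sub>R cl_one"
proof -
  have "cl_vec x \<star> cl_vec x = (1/2) *\<^sub>R (cl_vec x \<star> cl_vec x + cl_vec x \<star> cl_vec x)"
    by (simp flip: scaleR_2)
  also have "\<dots> = - (norm x)\<^sup>2 *\<^sub>R cl_one"
    unfolding clifford_relation by (simp add: power2_norm_eq_inner)
  finally show ?thesis .
qed

text \<open>For a unit vector \<open>x\<close> this is the reflection in the hyperplane orthogonal to \<open>x\<close>.\<close>

definition reflect :: "real^8 \<Rightarrow> real^8 \<Rightarrow> real^8" where
  "reflect x y = y - (2 * (x \<bullet> y)) *\<^sub>R x"

text \<open>Moving \<open>y\<close> to the right of \<open>x\<close> by the Clifford relation gives \<open>x y x = - x x y - 2 (x \<bullet> y) x\<close>, and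
\<open>x x = -1\<close>.\<close>

lemma cl_vec_reflect:
  assumes "norm x = 1"
  shows "cl_vec x \<star> cl_vec y \<star> cl_vec x = cl_vec (reflect x y)"
proof -
  have "cl_vec y \<star> cl_vec x = - (cl_vec x \<star> cl_vec y) + (- 2 * (x \<bullet> y)) *\<^sub>R cl_one"
    unfolding clifford_relation[symmetric] by simp
  then have "cl_vec x \<star> (cl_vec y \<star> cl_vec x)
      = - ((cl_vec x \<star> cl_vec x) \<star> cl_vec y) + (- 2 * (x \<bullet> y)) *\<^sub>R cl_vec x"
    by (simp add: cl_mult_diff cl_mult_scaleR_right cl_mult_assoc)
  also have "\<dots> = cl_vec (reflect x y)"
    using assms by (simp add: cl_vec_square reflect_def linear_diff[OF linear_cl_vec]
        linear_scale[OF linear_cl_vec])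
  finally show ?thesis by (simp add: cl_mult_assoc)
qed

section \<open>Octonions\<close>

lemma exhaust_8:
  fixes x :: 8
  shows "x = 1 \<or> x = 2 \<or> x = 3 \<or> x = 4 \<or> x = 5 \<or> x = 6 \<or> x = 7 \<or> x = 8"
proof (induct x)
  case (of_int z)
  then have "z = 0 \<or> z = 1 \<or> z = 2 \<or> z = 3 \<or> z = 4 \<or> z = 5 \<or> z = 6 \<or> z = 7"
    by simp arith
  then show ?case by auto
qed

lemma forall_8: "(\<forall>i::8. P i) \<longleftrightarrow> P 1 \<and> P 2 \<and> P 3 \<and> P 4 \<and> P 5 \<and> P 6 \<and> P 7 \<and> P 8"
  by (metis exhaust_8)

lemma UNIV_8: "UNIV = {1, 2, 3, 4, 5, 6, 7, 8::8}"
  using exhaust_8 by auto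

lemma sum_8: "sum f (UNIV::8 set) = f 1 + f 2 + f 3 + f 4 + f 5 + f 6 + f 7 + f 8"
  unfolding UNIV_8 by (simp add: ac_simps)

text \<open>The product \<open>conj(x) y\<close> of octonions in a basis of units whose first member is the identity.  The structure
constants are those of the Clifford multiplication by \<open>e\<^sub>j\<close> from \<open>plus_basis\<close> to \<open>minus_basis\<close>.  Since
\<open>minus_basis\<close> is \<open>e\<^sub>1\<close> times \<open>plus_basis\<close>, multiplication by \<open>e\<^sub>1\<close> is the identity matrix, so the identity of the
octonions is the first basis vector; the signs of the other seven matrices are accounted for by the conjugate.\<close>

definition oct :: "real^8 \<Rightarrow> real^8 \<Rightarrow> real^8" where
  "oct x y = (\<chi> i.
     if i = 1 then x$1 * y$1 + x$2 * y$2 + x$3 * y$3 + x$4 * y$4 + x$5 * y$5 + x$6 * y$6 + x$7 * y$7 + x$8 * y$8 else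
     if i = 2 then x$1 * y$2 - x$2 * y$1 - x$3 * y$4 + x$4 * y$3 - x$5 * y$6 + x$6 * y$5 - x$7 * y$8 + x$8 * y$7 else
     if i = 3 then x$1 * y$3 + x$2 * y$4 - x$3 * y$1 - x$4 * y$2 - x$5 * y$7 + x$6 * y$8 + x$7 * y$5 - x$8 * y$6 else
     if i = 4 then x$1 * y$4 - x$2 * y$3 + x$3 * y$2 - x$4 * y$1 + x$5 * y$8 + x$6 * y$7 - x$7 * y$6 - x$8 * y$5 else
     if i = 5 then x$1 * y$5 + x$2 * y$6 + x$3 * y$7 - x$4 * y$8 - x$5 * y$1 - x$6 * y$2 - x$7 * y$3 + x$8 * y$4 else
     if i = 6 then x$1 * y$6 - x$2 * y$5 - x$3 * y$8 - x$4 * y$7 + x$5 * y$2 - x$6 * y$1 + x$7 * y$4 + x$8 * y$3 else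
     if i = 7 then x$1 * y$7 + x$2 * y$8 - x$3 * y$5 + x$4 * y$6 + x$5 * y$3 - x$6 * y$4 - x$7 * y$1 - x$8 * y$2 else
     x$1 * y$8 - x$2 * y$7 + x$3 * y$6 + x$4 * y$5 - x$5 * y$4 - x$6 * y$3 + x$7 * y$2 - x$8 * y$1)"

lemma oct_nth:
  "oct x y $ 1 = x$1 * y$1 + x$2 * y$2 + x$3 * y$3 + x$4 * y$4 + x$5 * y$5 + x$6 * y$6 + x$7 * y$7 + x$8 * y$8"
  "oct x y $ 2 = x$1 * y$2 - x$2 * y$1 - x$3 * y$4 + x$4 * y$3 - x$5 * y$6 + x$6 * y$5 - x$7 * y$8 + x$8 * y$7"
  "oct x y $ 3 = x$1 * y$3 + x$2 * y$4 - x$3 * y$1 - x$4 * y$2 - x$5 * y$7 + x$6 * y$8 + x$7 * y$5 - x$8 * y$6"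
  "oct x y $ 4 = x$1 * y$4 - x$2 * y$3 + x$3 * y$2 - x$4 * y$1 + x$5 * y$8 + x$6 * y$7 - x$7 * y$6 - x$8 * y$5"
  "oct x y $ 5 = x$1 * y$5 + x$2 * y$6 + x$3 * y$7 - x$4 * y$8 - x$5 * y$1 - x$6 * y$2 - x$7 * y$3 + x$8 * y$4"
  "oct x y $ 6 = x$1 * y$6 - x$2 * y$5 - x$3 * y$8 - x$4 * y$7 + x$5 * y$2 - x$6 * y$1 + x$7 * y$4 + x$8 * y$3"
  "oct x y $ 7 = x$1 * y$7 + x$2 * y$8 - x$3 * y$5 + x$4 * y$6 + x$5 * y$3 - x$6 * y$4 - x$7 * y$1 - x$8 * y$2"
  "oct x y $ 8 = x$1 * y$8 - x$2 * y$7 + x$3 * y$6 + x$4 * y$5 - x$5 * y$4 - x$6 * y$3 + x$7 * y$2 - x$8 * y$1"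
  by (simp_all add: oct_def)

definition oconj :: "real^8 \<Rightarrow> real^8" where
  "oconj x = (\<chi> i. if i = 1 then x $ i else - x $ i)"

lemma oconj_nth: "oconj x $ i = (if i = 1 then x $ i else - x $ i)"
  by (simp add: oconj_def)

lemma oct_linear:
  "oct (x + x') y = oct x y + oct x' y" "oct x (y + y') = oct x y + oct x y'"
  "oct (c *\<^sub>R x) y = c *\<^sub>R oct x y" "oct x (c *\<^sub>R y) = c *\<^sub>R oct x y"
  by (simp_all add: vec_eq_iff forall_8 oct_nth algebra_simps)

lemma oconj_linear: "oconj (x + y) = oconj x + oconj y" "oconj (c *\<^sub>R x) = c *\<^sub>R oconj x"
  by (simp_all add: vec_eq_iff oconj_nth)

lemma oconj_oconj [simp]: "oconj (oconj x) = x"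
  by (simp add: vec_eq_iff oconj_nth)

lemma inner_oconj: "oconj x \<bullet> oconj y = x \<bullet> y"
  by (simp add: inner_vec_def sum_8 oconj_nth)

text \<open>Conjugation reverses products of octonions, so it exchanges the two arguments of \<open>oct\<close>.  This symmetry is the
source of the automorphism that lifts \<open>kappa_plus\<close>.\<close>

lemma oconj_oct: "oconj (oct x y) = oct y x"
  by (simp add: vec_eq_iff forall_8 oct_nth oconj_nth)

lemma oct_one: "oct (axis 1 1) y = y"
  by (simp add: vec_eq_iff forall_8 oct_nth axis_def)

lemma inner_oct: "oct x y \<bullet> z = y \<bullet> oct (oconj x) z"
  by (simp add: inner_vec_def sum_8 oct_nth oconj_nth algebra_simps)

text \<open>Left alternativity in the form \<open>x (conj(x) y) = (x \<bullet> x) y\<close>, which makes pairs of octonions a module over the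
Clifford algebra.\<close>

lemma oct_oconj_oct: "oct (oconj x) (oct x y) = (x \<bullet> x) *\<^sub>R y"
  by (simp add: vec_eq_iff forall_8 inner_vec_def sum_8 oct_nth oconj_nth algebra_simps)

text \<open>A map that commutes with all left multiplications is the right multiplication by \<open>c = X 1\<close>, and then \<open>c\<close>
associates with every pair of octonions.  Only the real octonions do: every imaginary coordinate of \<open>c\<close> is
killed by its associator with at least one of three pairs of imaginary units.\<close>

lemma commutant:
  assumes "\<And>x y. oct x (X y) = X (oct x y)"
  shows "\<exists>c. \<forall>y. X y = c *\<^sub>R y"
proof -
  let ?e = "axis 1 1 :: real^8"
  define c where "c = X ?e"
  have X: "X y = oct (oconj y) c" for y
    by (metis assms oconj_oct oconj_oconj oct_one c_def)
  have "oct x (oct (oconj y) c) = oct (oct y x) c" for x y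
    using assms[of x y] by (simp add: X oconj_oct)
  \<comment> \<open>The first pair leaves \<open>c\<close> in the quaternion subalgebra of the coordinates 1 to 4, the other two remove
    the coordinates 2, 3 and 4.\<close>
  from this[of "axis 2 1" "axis 3 1"] this[of "axis 2 1" "axis 5 1"] this[of "axis 3 1" "axis 5 1"]
  have "c $ 2 = 0 \<and> c $ 3 = 0 \<and> c $ 4 = 0 \<and> c $ 5 = 0 \<and> c $ 6 = 0 \<and> c $ 7 = 0 \<and> c $ 8 = 0"
    by (simp add: vec_eq_iff forall_8 oct_nth oconj_nth axis_def)
  then have "c = c $ 1 *\<^sub>R ?e"
    by (simp add: vec_eq_iff forall_8 axis_def)
  then have "X y = (c $ 1) *\<^sub>R y" for y
    by (metis X oct_linear(4) oconj_oct oconj_oconj oct_one)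
  then show ?thesis by blast
qed

section \<open>The Clifford module of pairs of octonions\<close>

text \<open>Clifford multiplication by a vector, in octonionic coordinates for the pair of a positive and a negative
half-spinor.\<close>

definition dirac_op :: "real^8 \<Rightarrow> (real^8) \<times> (real^8) \<Rightarrow> (real^8) \<times> (real^8)" where
  "dirac_op x w = (- oct (oconj x) (snd w), oct x (fst w))"

lemma linear_dirac_op: "linear (dirac_op x)"
  by (rule linearI) (simp_all add: dirac_op_def oct_linear)

lemma linear_dirac_op_left: "linear (\<lambda>x. dirac_op x w)"
  by (rule linearI) (simp_all add: dirac_op_def oct_linear oconj_linear)

lemma dirac_op_square: "dirac_op x (dirac_op x w) = - (x \<bullet> x) *\<^sub>R w"
proof -
  have "oct x (oct (oconj x) z) = (x \<bullet> x) *\<^sub>R z" for z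
    using oct_oconj_oct[of "oconj x" z] by (simp add: inner_oconj)
  moreover have "oct a (- b) = - oct a b" for a b
    using oct_linear(4)[of a "-1" b] by simp
  ultimately show ?thesis
    by (simp add: dirac_op_def oct_oconj_oct prod_eq_iff)
qed

lemma dirac_op_relation:
  "dirac_op x (dirac_op y w) + dirac_op y (dirac_op x w) = - (2 * (x \<bullet> y)) *\<^sub>R w"
proof -
  have "dirac_op (x + y) (dirac_op (x + y) w) = dirac_op x (dirac_op x w)
      + (dirac_op x (dirac_op y w) + dirac_op y (dirac_op x w)) + dirac_op y (dirac_op y w)"
    by (simp add: linear_add[OF linear_dirac_op] linear_add[OF linear_dirac_op_left])
  then show ?thesis
    unfolding dirac_op_square by (simp add: inner_add_left inner_add_right inner_commute algebra_simps)
qed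

lemma norm_dirac_op: "norm (dirac_op x w) = norm x * norm w"
proof -
  have n: "(oct a b) \<bullet> (oct a b) = (a \<bullet> a) * (b \<bullet> b)" for a b
    by (simp add: inner_oct oct_oconj_oct)
  have "dirac_op x w \<bullet> dirac_op x w = (x \<bullet> x) * (w \<bullet> w)"
    by (simp add: dirac_op_def inner_prod_def n inner_oconj algebra_simps)
  then show ?thesis
    by (simp add: norm_eq_sqrt_inner real_sqrt_mult)
qed

abbreviation axis_op :: "nat \<Rightarrow> (real^8) \<times> (real^8) \<Rightarrow> (real^8) \<times> (real^8)" where
  "axis_op j \<equiv> dirac_op (axis (of_nat j) 1)"

lemma axis_op_square: "axis_op j (axis_op j w) = - w"
  by (simp add: dirac_op_square inner_axis_axis)

lemma axis_op_anticommute: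
  assumes "j \<in> {1..8}" "k \<in> {1..8}" "j \<noteq> k"
  shows "axis_op j (axis_op k w) = - axis_op k (axis_op j w)"
proof -
  have "(of_nat j :: 8) \<noteq> of_nat k"
    using assms label_unique by blast
  then have "axis (of_nat j :: 8) (1::real) \<bullet> axis (of_nat k) 1 = 0"
    by (simp add: inner_axis_axis)
  then show ?thesis
    using dirac_op_relation[of "axis (of_nat j) 1" "axis (of_nat k) 1" w]
    by (simp add: eq_neg_iff_add_eq_0)
qed

text \<open>The operator of the sorted word of \<open>S\<close>, that is, of the basis element of the Clifford algebra with labels \<open>S\<close>.\<close>

definition word_op :: "nat set \<Rightarrow> (real^8) \<times> (real^8) \<Rightarrow> (real^8) \<times> (real^8)" where
  "word_op S = foldr axis_op (sorted_list_of_set S)"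

lemma linear_word_op: "linear (word_op S)"
proof -
  have "linear (foldr axis_op xs)" for xs
    by (induction xs)
      (simp_all add: linear_iff linear_add[OF linear_dirac_op] linear_scale[OF linear_dirac_op])
  then show ?thesis
    by (simp add: word_op_def)
qed

lemma word_op_empty [simp]: "word_op {} w = w"
  by (simp add: word_op_def)

lemma word_op_insert:
  assumes "finite S" "\<forall>k\<in>S. m < k"
  shows "word_op (insert m S) w = axis_op m (word_op S w)"
proof -
  have "m \<notin> S"
    using assms(2) by auto
  then have "sorted_list_of_set (insert m S) = m # sorted_list_of_set S"
    using assms by (simp add: insort_is_Cons less_imp_le)
  then show ?thesis
    by (simp add: word_op_def)
qed

text \<open>Adding a new least element to a set of labels adds a new first letter to its sorted word.\<close>

lemma finite_min_induct [consumes 1, case_names empty insert]: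
  fixes S :: "nat set"
  assumes "finite S" "P {}"
    "\<And>m S. \<lbrakk>finite S; \<forall>k\<in>S. m < k; P S\<rbrakk> \<Longrightarrow> P (insert m S)"
  shows "P S"
  using assms(1)
proof (induction "card S" arbitrary: S)
  case 0
  then show ?case using assms(2) by simp
next
  case (Suc n)
  let ?m = "Min S"
  have S: "S \<noteq> {}" "finite S"
    using Suc by auto
  then have m: "?m \<in> S" "\<forall>k\<in>S. ?m \<le> k"
    by simp_all
  then have "S = insert ?m (S - {?m})" "\<forall>k\<in>S - {?m}. ?m < k"
    by (auto simp: order.strict_iff_order)
  moreover have "P (S - {?m})"
    using Suc S by simp
  ultimately show ?case
    using assms(3)[of "S - {?m}" ?m] S(2) by simp
qed

text \<open>The generator \<open>e\<^sub>j\<close> moves to its place in the sorted word past the smaller letters, with one sign for each, and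
meets there either a larger letter or another \<open>e\<^sub>j\<close>, which adds the sign of \<open>e\<^sub>j e\<^sub>j = -1\<close>.\<close>

lemma axis_op_word_op:
  assumes "finite S" "S \<subseteq> {1..8}" "j \<in> {1..8}"
  shows "axis_op j (word_op S w) = inversion_sign {j} S *\<^sub>R word_op (sym_diff {j} S) w"
  using assms
proof (induction S rule: finite_min_induct)
  case empty
  then show ?case
    by (simp add: word_op_insert inversion_sign_def)
next
  case (insert m S)
  have m: "m \<notin> S" "m \<in> {1..8}"
    using insert by auto
  consider "j < m" | "j = m" | "m < j"
    by linarith
  then show ?case
  proof cases
    case 1
    then have less: "\<forall>k\<in>insert m S. j < k"
      using insert by auto
    then have "sym_diff {j} (insert m S) = insert j (insert m S)"
      by auto
    moreover have "inversion_sign {j} (insert m S) = 1"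
      using less unfolding inversion_sign_def by (auto intro!: prod.neutral simp: not_le)
    ultimately show ?thesis
      using less insert by (simp add: word_op_insert[of "insert m S"])
  next
    case 2
    have "sym_diff {j} (insert m S) = S"
      using 2 m by auto
    moreover have "inversion_sign {j} S = 1"
      using insert 2 unfolding inversion_sign_def by (auto intro!: prod.neutral simp: not_le)
    then have "inversion_sign {j} (insert m S) = -1"
      using 2 m insert by (simp add: inversion_sign_def)
    ultimately show ?thesis
      using insert 2 by (simp add: word_op_insert axis_op_square)
  next
    case 3
    have "axis_op j (word_op (insert m S) w) = - axis_op m (axis_op j (word_op S w))"
      using insert 3 m by (simp add: word_op_insert axis_op_anticommute[of j m])
    also have "\<dots> = - (inversion_sign {j} S *\<^sub>R axis_op m (word_op (sym_diff {j} S) w))"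
      using insert by (simp add: linear_scale[OF linear_dirac_op])
    also have "axis_op m (word_op (sym_diff {j} S) w) = word_op (insert m (sym_diff {j} S)) w"
      using insert 3 by (subst word_op_insert) auto
    also have "insert m (sym_diff {j} S) = sym_diff {j} (insert m S)"
      using 3 m by auto
    also have "- (inversion_sign {j} S *\<^sub>R word_op (sym_diff {j} (insert m S)) w)
        = inversion_sign {j} (insert m S) *\<^sub>R word_op (sym_diff {j} (insert m S)) w"
      using 3 m insert by (simp add: inversion_sign_def)
    finally show ?thesis .
  qed
qed

text \<open>The least letter of the left word has no inversions with the rest of that word, so only its inversions with
\<open>T\<close> contribute when it is moved into the sorted product.\<close>

lemma word_op_mult:
  assumes "finite S" "S \<subseteq> {1..8}" "finite T" "T \<subseteq> {1..8}"
  shows "word_op S (word_op T w) = inversion_sign S T *\<^sub>R word_op (sym_diff S T) w"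
  using assms(1,2)
proof (induction S rule: finite_min_induct)
  case empty
  then show ?case
    by (simp add: inversion_sign_def)
next
  case (insert m S)
  have m: "m \<notin> S" "m \<in> {1..8}"
    using insert by auto
  have fin: "finite (sym_diff S T)" "sym_diff S T \<subseteq> {1..8}"
    using insert assms by auto
  have "word_op (insert m S) (word_op T w)
      = inversion_sign S T *\<^sub>R axis_op m (word_op (sym_diff S T) w)"
    using insert by (simp add: word_op_insert linear_scale[OF linear_dirac_op])
  also have "\<dots> = (inversion_sign S T * inversion_sign {m} (sym_diff S T))
      *\<^sub>R word_op (sym_diff {m} (sym_diff S T)) w"
    using axis_op_word_op[OF fin m(2)] by simp
  also have "inversion_sign {m} (sym_diff S T) = inversion_sign {m} T"
  proof -
    have "inversion_sign {m} S = 1"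
      using insert unfolding inversion_sign_def by (auto intro!: prod.neutral simp: not_le)
    then show ?thesis
      using insert assms by (simp add: inversion_sign_sym_diff_right)
  qed
  also have "inversion_sign S T * inversion_sign {m} T = inversion_sign (insert m S) T"
    using m insert by (simp add: inversion_sign_def)
  also have "sym_diff {m} (sym_diff S T) = sym_diff (insert m S) T"
    using m by auto
  finally show ?case .
qed

text \<open>The action \<open>cl_act\<close> of the Clifford algebra on spinors, transported to pairs of octonions.\<close>

definition act :: "cl8 \<Rightarrow> (real^8) \<times> (real^8) \<Rightarrow> (real^8) \<times> (real^8)" where
  "act x w = (\<Sum>A\<in>UNIV. x $ A *\<^sub>R word_op (labels A) w)"

lemma linear_act: "linear (act x)"
  by (rule linearI) (simp_all add: act_def linear_add[OF linear_word_op]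
      linear_scale[OF linear_word_op] sum.distrib algebra_simps scaleR_sum_right)

lemma linear_act_left: "linear (\<lambda>x. act x w)"
  by (rule linearI) (simp_all add: act_def sum.distrib algebra_simps scaleR_sum_right)

lemma act_basis: "act (cl_basis A) w = word_op (labels A) w"
proof -
  have "act (cl_basis A) w = (\<Sum>B\<in>UNIV. if B = A then word_op (labels A) w else 0)"
    unfolding act_def by (intro sum.cong refl) (simp add: cl_basis_def axis_def)
  then show ?thesis
    by simp
qed

lemma act_one [simp]: "act cl_one w = w"
  by (simp add: cl_one_def act_basis)

lemma labels_subset: "labels A \<subseteq> {1..8}"
  by (auto simp: labels_def)

lemma act_mult: "act (x \<star> y) w = act x (act y w)"
proof -
  note lin = linear_add[OF linear_act] linear_scale[OF linear_act]
    linear_add[OF linear_act_left] linear_scale[OF linear_act_left]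
  have b: "act (cl_basis A \<star> cl_basis B) w = act (cl_basis A) (act (cl_basis B) w)" for A B
    by (simp add: cl_mult_basis act_basis lin cl_sign_eq labels_sym_diff
        word_op_mult[OF finite_labels labels_subset finite_labels labels_subset])
  have bb: "act (cl_basis A \<star> y) w = act (cl_basis A) (act y w)" for A
    by (rule cl_linear_eqI[of "\<lambda>y. act (cl_basis A \<star> y) w"])
      (simp_all add: linear_iff cl_mult_simps lin b)
  show ?thesis
    by (rule cl_linear_eqI[of "\<lambda>x. act (x \<star> y) w"])
      (simp_all add: linear_iff cl_mult_simps lin bb)
qed

lemma act_vec: "act (cl_vec x) w = dirac_op x w"
proof -
  have b: "act (cl_basis {i}) w = dirac_op (axis i 1) w" for i
  proof -
    obtain j where j: "j \<in> {1..8}" "i = of_nat j"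
      by (rule label_exists)
    then show ?thesis
      by (simp add: act_basis labels_singleton word_op_insert)
  qed
  have "x = (\<Sum>i\<in>UNIV. x $ i *\<^sub>R axis i 1)"
    by (simp add: vec_eq_iff axis_def if_distrib cong: if_cong)
  then have "dirac_op x w = (\<Sum>i\<in>UNIV. x $ i *\<^sub>R dirac_op (axis i 1) w)"
    by (metis (no_types, lifting) linear_sum[OF linear_dirac_op_left] linear_scale[OF linear_dirac_op_left] sum.cong)
  then show ?thesis
    by (simp add: cl_vec_def linear_sum[OF linear_act_left] linear_scale[OF linear_act_left] b)
qed

section \<open>Faithfulness of the Clifford module\<close>

text \<open>The sign \<open>s\<close> with \<open>e\<^sub>i e\<^sub>A = s e\<^sub>A e\<^sub>i\<close>.\<close>

definition commutation_sign :: "8 \<Rightarrow> 8 set \<Rightarrow> real" where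
  "commutation_sign i A = cl_sign {i} A * cl_sign A {i}"

text \<open>If \<open>A\<close> has an even number of elements, each of them gives an anticommuting generator.  If the number is odd,
then \<open>A\<close> is not the set of all eight indices, and any index outside \<open>A\<close> will do.\<close>

lemma anticommuting_generator:
  assumes "A \<noteq> {}"
  shows "\<exists>i. commutation_sign i A = -1"
proof -
  let ?S = "labels A"
  have sign: "commutation_sign (of_nat j) A = (-1) ^ card (?S - {j})" if "j \<in> {1..8}" for j
  proof -
    have "commutation_sign (of_nat j) A
        = (\<Prod>k\<in>?S. (if k \<le> j then -1 else 1) * (if j \<le> k then -1 else 1))"
      using that by (simp add: commutation_sign_def cl_sign_eq labels_singleton inversion_sign_def
          prod.distrib)
    also have "\<dots> = (\<Prod>k\<in>?S - {j}. -1)"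
      by (rule prod.mono_neutral_cong_right) auto
    finally show ?thesis by simp
  qed
  obtain i where "i \<in> A"
    using assms by blast
  moreover obtain j where "j \<in> {1..8}" "i = of_nat j"
    by (rule label_exists)
  ultimately have j: "j \<in> ?S"
    by (simp add: labels_def)
  show ?thesis
  proof (cases "even (card ?S)")
    case True
    have "card ?S = Suc (card (?S - {j}))"
      by (rule card.remove) (use j in simp_all)
    then have "odd (card (?S - {j}))"
      using True by simp
    then show ?thesis
      using sign[of j] subsetD[OF labels_subset j] by (intro exI[of _ "of_nat j"]) simp
  next
    case False
    then have "?S \<noteq> {1..8}"
      by auto
    then obtain k where k: "k \<in> {1..8}" "k \<notin> ?S"
      using labels_subset[of A] by blast
    then show ?thesis
      using sign[of k] False by (intro exI[of _ "of_nat k"]) simp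
  qed
qed

lemma conjugate_coeff: "(cl_basis {i} \<star> x \<star> cl_basis {i}) $ A = - commutation_sign i A * x $ A"
proof -
  have b: "cl_basis {i} \<star> cl_basis B \<star> cl_basis {i} = - commutation_sign i B *\<^sub>R cl_basis B" for B
  proof -
    have "sym_diff (sym_diff {i} B) {i} = B" by auto
    moreover have "cl_sign (sym_diff {i} B) {i} = - cl_sign B {i}"
    proof -
      obtain j where j: "j \<in> {1..8}" "i = of_nat j"
        by (rule label_exists)
      then have "cl_sign {i} {i} = -1"
        by (simp add: cl_sign_eq labels_singleton inversion_sign_def)
      then show ?thesis
        by (simp add: cl_sign_eq labels_sym_diff inversion_sign_sym_diff_left)
    qed
    ultimately show ?thesis
      by (simp add: cl_mult_basis cl_mult_simps commutation_sign_def)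
  qed
  show ?thesis
    by (rule cl_linear_eqI[of "\<lambda>x. (cl_basis {i} \<star> x \<star> cl_basis {i}) $ A"])
      (simp_all add: linear_iff cl_mult_simps b algebra_simps, simp add: cl_basis_def axis_def)
qed

text \<open>The annihilator of the module is a two-sided ideal, so it is enough to show that its elements have no scalar
part: for the other coefficients multiply by a basis element.  Averaging \<open>x\<close> with \<open>- e\<^sub>i x e\<^sub>i\<close> stays in the ideal,
keeps the scalar part, and removes the basis elements that anticommute with \<open>e\<^sub>i\<close>.  After this has been done for
all \<open>i\<close> only the scalar part is left, and a scalar that acts as zero is zero.\<close>

lemma act_faithful:
  assumes "\<And>w. act x w = 0"
  shows "x = 0"
proof -
  have scalar_part: "x $ {} = 0" if x: "\<And>w. act x w = 0" for x
  proof -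
    have "\<exists>r. (\<forall>w. act r w = 0) \<and> r $ {} = x $ {} \<and>
        (\<forall>A. r $ A \<noteq> 0 \<longrightarrow> (\<forall>i\<in>I. commutation_sign i A \<noteq> -1))" if "finite I" for I
      using that
    proof (induction I rule: finite_induct)
      case empty
      then show ?case
        using x by auto
    next
      case (insert i I)
      then obtain r where r: "\<forall>w. act r w = 0" "r $ {} = x $ {}"
          "\<forall>A. r $ A \<noteq> 0 \<longrightarrow> (\<forall>i\<in>I. commutation_sign i A \<noteq> -1)"
        by blast
      define r' where "r' = (1/2) *\<^sub>R (r - cl_basis {i} \<star> r \<star> cl_basis {i})"
      have coeff: "r' $ A = ((1 + commutation_sign i A) / 2) * r $ A" for A
        by (simp add: r'_def conjugate_coeff field_simps)
      have "act r' w = 0" for w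
        by (simp add: r(1)[rule_format] r'_def linear_scale[OF linear_act_left]
            linear_diff[OF linear_act_left] act_mult linear_0[OF linear_act])
      moreover have "r' $ {} = x $ {}"
        using r(2) by (simp add: coeff commutation_sign_def)
      moreover have "\<forall>A. r' $ A \<noteq> 0 \<longrightarrow> (\<forall>j\<in>insert i I. commutation_sign j A \<noteq> -1)"
        using r(3) by (auto simp: coeff)
      ultimately show ?case
        by blast
    qed
    from this[of UNIV] obtain r where r: "\<forall>w. act r w = 0" "r $ {} = x $ {}"
        "\<forall>A. r $ A \<noteq> 0 \<longrightarrow> (\<forall>i. commutation_sign i A \<noteq> -1)"
      by auto
    have "r $ A = 0" if "A \<noteq> {}" for A
      using anticommuting_generator[OF that] r(3) by blast
    then have "r = x $ {} *\<^sub>R cl_one"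
      using r(2) by (simp add: vec_eq_iff cl_one_def cl_basis_def axis_def)
    then have "x $ {} *\<^sub>R (axis 1 1, 0) = (0 :: (real^8) \<times> (real^8))"
      using r(1) by (metis act_one linear_scale[OF linear_act_left])
    then show ?thesis
      by (simp add: zero_prod_def axis_eq_0_iff)
  qed
  have "x $ A = 0" for A
  proof -
    have "act (cl_basis A \<star> x) w = 0" for w
      by (simp add: act_mult assms linear_0[OF linear_act])
    then have "(cl_basis A \<star> x) $ {} = 0"
      by (rule scalar_part)
    moreover have "(cl_basis A \<star> x) $ {} = cl_sign A A * x $ A"
    proof (rule cl_linear_eqI[of "\<lambda>x. (cl_basis A \<star> x) $ {}"])
      fix B
      show "(cl_basis A \<star> cl_basis B) $ {} = cl_sign A A * cl_basis B $ A"
        unfolding cl_mult_basis by (cases "A = B") (auto simp: cl_basis_def axis_def)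
    qed (simp_all add: linear_iff cl_mult_simps algebra_simps)
    ultimately show ?thesis
      using cl_sign_square[of A A] by auto
  qed
  then show ?thesis
    by (simp add: vec_eq_iff)
qed

section \<open>Reflections generate the orthogonal group\<close>

lemma linear_reflect: "linear (reflect x)"
  by (rule linearI) (simp_all add: reflect_def inner_add_right algebra_simps)

lemma linear_foldr_reflect: "linear (foldr reflect xs)"
  by (induction xs)
    (simp_all add: linear_iff linear_add[OF linear_reflect] linear_scale[OF linear_reflect])

lemma reflect_reflect: "norm x = 1 \<Longrightarrow> reflect x (reflect x y) = y"
  by (simp add: reflect_def inner_diff_right norm_eq_1 algebra_simps)

lemma inner_reflect: "norm x = 1 \<Longrightarrow> reflect x y \<bullet> reflect x z = y \<bullet> z"
  by (simp add: reflect_def inner_diff_right inner_diff_left norm_eq_1 inner_commute algebra_simps)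

text \<open>The hyperplane orthogonal to \<open>x - y\<close> is the perpendicular bisector of the two vectors.\<close>

lemma reflect_onto:
  assumes "norm x = norm y" "x \<noteq> y"
  shows "reflect ((x - y) /\<^sub>R norm (x - y)) x = y"
proof -
  let ?d = "x - y"
  have "?d \<bullet> ?d = 2 * (?d \<bullet> x)"
    using assms(1) by (simp add: norm_eq inner_diff_left inner_diff_right inner_commute)
  then have "2 * (?d \<bullet> x) = norm ?d * norm ?d"
    by (simp add: power2_norm_eq_inner flip: power2_eq_square)
  moreover have "2 * ((?d /\<^sub>R norm ?d) \<bullet> x) = (2 * (?d \<bullet> x)) / norm ?d"
    by (simp only: inner_scaleR_left divide_inverse mult_ac)
  ultimately have "2 * ((?d /\<^sub>R norm ?d) \<bullet> x) = norm ?d"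
    using assms(2) by simp
  then show ?thesis
    using assms(2) by (simp add: reflect_def)
qed

lemma reflect_transitive:
  assumes "norm x = 1" "norm y = 1"
  obtains z where "norm z = 1" "reflect z x = y"
proof (cases "x = y")
  case True
  obtain v :: "real^8" where v: "v \<noteq> 0" "orthogonal x v"
    using orthogonal_to_vector_exists[of x] by auto
  show ?thesis
  proof (rule that)
    show "norm (v /\<^sub>R norm v) = 1"
      using v by simp
    show "reflect (v /\<^sub>R norm v) x = y"
      using v True by (simp add: reflect_def orthogonal_def inner_commute)
  qed
next
  case False
  then show ?thesis
    using assms by (intro that[of "(x - y) /\<^sub>R norm (x - y)"] reflect_onto) auto
qed

lemma orthogonal_transformation_foldr_reflect:
  assumes "\<forall>x\<in>set xs. norm x = 1"
  shows "orthogonal_transformation (foldr reflect xs)"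
proof -
  have "foldr reflect xs v \<bullet> foldr reflect xs w = v \<bullet> w" for v w
    using assms by (induction xs) (simp_all add: inner_reflect)
  then show ?thesis
    by (simp add: orthogonal_transformation_def linear_foldr_reflect)
qed

lemma foldr_reflect_rev:
  assumes "\<forall>x\<in>set xs. norm x = 1"
  shows "foldr reflect (rev xs) (foldr reflect xs v) = v"
  using assms by (induction xs arbitrary: v) (simp_all add: reflect_reflect)

text \<open>The theorem of Cartan and Dieudonne.  The axes are moved back to their places one at a time; the reflection
that does this for the next axis leaves the previous ones fixed, because they are orthogonal both to that axis
and to its image.\<close>

theorem orthogonal_is_product_of_reflections:
  assumes f: "orthogonal_transformation f"
  obtains xs where "\<forall>x\<in>set xs. norm x = 1" "f = foldr reflect xs"
proof -
  have "\<exists>xs. (\<forall>x\<in>set xs. norm x = 1) \<and> (\<forall>i\<in>S. foldr reflect xs (f (axis i 1)) = axis i 1)"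
    if "finite S" for S
    using that
  proof (induction S rule: finite_induct)
    case empty
    have "\<forall>x\<in>set []. norm (x :: real^8) = 1" by simp
    then show ?case by blast
  next
    case (insert i S)
    then obtain xs where xs: "\<forall>x\<in>set xs. norm x = 1"
        "\<forall>j\<in>S. foldr reflect xs (f (axis j 1)) = axis j 1"
      by blast
    define g where "g = foldr reflect xs \<circ> f"
    have g: "orthogonal_transformation g"
      unfolding g_def by (intro orthogonal_transformation_compose f
          orthogonal_transformation_foldr_reflect xs)
    let ?e = "\<lambda>i. axis i 1 :: real^8"
    show ?case
    proof (cases "g (?e i) = ?e i")
      case True
      then show ?thesis
        using xs by (intro exI[of _ xs]) (auto simp: g_def)
    next
      case False
      let ?d = "g (?e i) - ?e i"
      let ?z = "?d /\<^sub>R norm ?d"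
      have norm: "norm (g (?e i)) = norm (?e i)"
        using g by (simp add: orthogonal_transformation_norm)
      have "reflect ?z (g (?e j)) = ?e j" if "j \<in> S" for j
      proof -
        have gj: "g (?e j) = ?e j"
          using xs that by (simp add: g_def)
        have "g (?e i) \<bullet> ?e j = ?e i \<bullet> ?e j"
          using g gj unfolding orthogonal_transformation_def by metis
        then show ?thesis
          by (simp add: gj reflect_def inner_diff_left)
      qed
      moreover have "reflect ?z (g (?e i)) = ?e i"
        using reflect_onto[OF norm False] .
      moreover have "norm ?z = 1"
        using False by simp
      ultimately show ?thesis
        using xs(1) by (intro exI[of _ "?z # xs"]) (simp add: g_def)
    qed
  qed
  from this[of UNIV] obtain xs where xs: "\<forall>x\<in>set xs. norm x = 1"
      "\<forall>i. foldr reflect xs (f (axis i 1)) = axis i 1"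
    by auto
  have "linear f"
    using f by (simp add: orthogonal_transformation_def)
  have "foldr reflect xs \<circ> f = id"
  proof (rule linear_eq_stdbasis)
    show "linear (foldr reflect xs \<circ> f)"
      using \<open>linear f\<close> linear_foldr_reflect by (rule linear_compose)
  qed (use xs in \<open>auto simp: linear_id Basis_vec_def\<close>)
  then have id: "foldr reflect xs (f v) = v" for v
    by (metis comp_apply id_apply)
  have "f v = foldr reflect (rev xs) v" for v
    using foldr_reflect_rev[OF xs(1), of "f v"] by (simp add: id)
  then show ?thesis
    using xs(1) by (intro that[of "rev xs"]) auto
qed

section \<open>The spin group and its vector representation\<close>

lemma cl_prod_simps [simp]:
  "cl_prod [] = cl_one" "cl_prod (x # xs) = cl_vec x \<star> cl_prod xs"
  by (simp_all add: cl_prod_def)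

lemma cl_prod_append [simp]: "cl_prod (xs @ ys) = cl_prod xs \<star> cl_prod ys"
  by (induction xs) (simp_all add: cl_mult_assoc)

lemma cl_prod_mult_rev:
  assumes "\<forall>x\<in>set xs. norm x = 1"
  shows "cl_prod xs \<star> cl_prod (rev xs) = (-1) ^ length xs *\<^sub>R cl_one"
  using assms
proof (induction xs)
  case (Cons x xs)
  have "cl_prod (x # xs) \<star> cl_prod (rev (x # xs))
      = cl_vec x \<star> (cl_prod xs \<star> cl_prod (rev xs)) \<star> cl_vec x"
    by (simp add: cl_mult_assoc)
  then show ?case
    using Cons by (simp add: cl_mult_simps cl_vec_square)
qed simp

lemma cl_prod_sandwich:
  assumes "\<forall>x\<in>set xs. norm x = 1"
  shows "cl_prod xs \<star> cl_vec y \<star> cl_prod (rev xs) = cl_vec (foldr reflect xs y)"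
  using assms
proof (induction xs)
  case (Cons x xs)
  have "cl_prod (x # xs) \<star> cl_vec y \<star> cl_prod (rev (x # xs))
      = cl_vec x \<star> (cl_prod xs \<star> cl_vec y \<star> cl_prod (rev xs)) \<star> cl_vec x"
    by (simp add: cl_mult_assoc)
  then show ?case
    using Cons by (simp add: cl_vec_reflect)
qed simp

lemma unit_wordD: "unit_word xs \<Longrightarrow> \<forall>x\<in>set xs. norm x = 1"
  by (simp add: unit_word_def)

lemma unit_word_append: "unit_word xs \<Longrightarrow> unit_word ys \<Longrightarrow> unit_word (xs @ ys)"
  by (auto simp: unit_word_def)

lemma unit_word_rev: "unit_word xs \<Longrightarrow> unit_word (rev xs)"
  by (auto simp: unit_word_def)

lemma unit_word_inverse:
  assumes "unit_word xs"
  shows "cl_prod xs \<star> cl_prod (rev xs) = cl_one" "cl_prod (rev xs) \<star> cl_prod xs = cl_one"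
  using cl_prod_mult_rev[OF unit_wordD[OF assms]]
    cl_prod_mult_rev[OF unit_wordD[OF unit_word_rev[OF assms]]] assms
  by (simp_all add: unit_word_def)

lemma Spin8_simps [simp]: "mult Spin8 = (\<star>)" "one Spin8 = cl_one"
  by (simp_all add: Spin8_def)

lemma SpinE:
  assumes "g \<in> carrier Spin8"
  obtains xs where "unit_word xs" "g = cl_prod xs"
  using assms by (auto simp: Spin8_def)

lemma SpinI: "unit_word xs \<Longrightarrow> cl_prod xs \<in> carrier Spin8"
  by (auto simp: Spin8_def)

lemma Spin_mult: "g \<in> carrier Spin8 \<Longrightarrow> h \<in> carrier Spin8 \<Longrightarrow> g \<star> h \<in> carrier Spin8"
  by (metis SpinE SpinI cl_prod_append unit_word_append)

lemma Spin_one: "cl_one \<in> carrier Spin8"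
  using SpinI[of "[]"] by (simp add: unit_word_def)

lemma Spin_inverse:
  assumes "g \<in> carrier Spin8"
  obtains h where "h \<in> carrier Spin8" "g \<star> h = cl_one" "h \<star> g = cl_one"
  using assms by (metis SpinE SpinI unit_word_rev unit_word_inverse)

lemma group_Spin8: "group Spin8"
proof (rule groupI)
  fix x assume "x \<in> carrier Spin8"
  then show "\<exists>y\<in>carrier Spin8. y \<otimes>\<^bsub>Spin8\<^esub> x = \<one>\<^bsub>Spin8\<^esub>"
    by (metis Spin_inverse Spin8_simps)
qed (auto simp: Spin_mult Spin_one cl_mult_assoc)

lemma Spin_minus:
  assumes "g \<in> carrier Spin8"
  shows "- g \<in> carrier Spin8"
proof -
  let ?e = "axis 1 1 :: real^8"
  have "cl_prod [?e, ?e] = - cl_one"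
    by (simp add: cl_vec_square)
  then have "- cl_one \<in> carrier Spin8"
    by (metis SpinI unit_word_def even_two_times_div_two length_Cons list.size(3) set_ConsD
        norm_axis_1 empty_iff empty_set even_Suc_Suc_iff even_zero)
  then show ?thesis
    using Spin_mult[OF _ assms] by fastforce
qed

text \<open>If the reflection in \<open>z\<close> takes \<open>x\<close> to \<open>y\<close>, then \<open>(x z) (x z) = x (z x z) = x y\<close>.\<close>

lemma unit_pair_is_square:
  assumes "norm x = 1" "norm y = 1"
  obtains h where "h \<in> carrier Spin8" "cl_vec x \<star> cl_vec y = h \<star> h"
proof -
  obtain z where z: "norm z = 1" "reflect z x = y"
    using reflect_transitive assms by blast
  have "cl_vec x \<star> cl_vec y = cl_prod [x, z] \<star> cl_prod [x, z]"
    using z cl_vec_reflect[of z x] by (simp add: cl_mult_assoc)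
  then show ?thesis
    using z assms by (intro that[of "cl_prod [x, z]"] SpinI) (auto simp: unit_word_def)
qed

text \<open>Since squares generate the group, a sign that depends multiplicatively on the group element is trivial.  This
plays the part of connectedness for determinants and for the uniqueness of lifts.\<close>

lemma Spin_square_induct [consumes 1, case_names one square mult]:
  assumes "g \<in> carrier Spin8" "P cl_one"
    and square: "\<And>h. h \<in> carrier Spin8 \<Longrightarrow> P (h \<star> h)"
    and mult: "\<And>g h. \<lbrakk>g \<in> carrier Spin8; h \<in> carrier Spin8; P g; P h\<rbrakk> \<Longrightarrow> P (g \<star> h)"
  shows "P g"
proof -
  have "unit_word xs \<Longrightarrow> P (cl_prod xs)" for xs
  proof (induction "length xs" arbitrary: xs rule: less_induct)
    case less
    show ?case
    proof (cases xs)
      case Nil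
      then show ?thesis using assms(2) by simp
    next
      case (Cons x xs')
      then obtain y ys where xs: "xs = x # y # ys"
        using less(2) by (cases xs') (auto simp: unit_word_def)
      obtain h where h: "h \<in> carrier Spin8" "cl_vec x \<star> cl_vec y = h \<star> h"
        using unit_pair_is_square[of x y] less(2) xs by (auto simp: unit_word_def)
      have ys: "unit_word ys"
        using less(2) xs by (auto simp: unit_word_def)
      then have "P (cl_prod ys)"
        using less(1)[of ys] xs by simp
      then have "P ((h \<star> h) \<star> cl_prod ys)"
        by (rule mult[OF Spin_mult[OF h(1) h(1)] SpinI[OF ys] square[OF h(1)]])
      then show ?thesis
        using h(2) xs by (metis cl_prod_simps(2) cl_mult_assoc)
    qed
  qed
  then show ?thesis
    using assms(1) SpinE by blast
qed

lemma matrix_foldr_reflect: "matrix (foldr reflect xs) *v y = foldr reflect xs y"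
  by (simp add: matrix_works linear_foldr_reflect)

text \<open>The reversed word is the inverse of an even word of unit vectors, so the map \<open>y \<mapsto> g y g\<^sup>-\<^sup>1\<close> depends only on the
product \<open>g\<close> and the definite description in \<open>lambda8\<close> denotes.\<close>

lemma lambda8_word:
  assumes "unit_word xs"
  shows "lambda8 (cl_prod xs) = matrix (foldr reflect xs)"
  unfolding lambda8_def
proof (rule the_equality)
  show "\<forall>ys. unit_word ys \<and> cl_prod xs = cl_prod ys \<longrightarrow>
     (\<forall>y. cl_vec (matrix (foldr reflect xs) *v y) = cl_prod ys \<star> cl_vec y \<star> cl_prod (rev ys))"
  proof (intro allI impI, elim conjE)
    fix ys y assume ys: "unit_word ys" "cl_prod xs = cl_prod ys"
    have "cl_prod (rev ys) = cl_prod (rev ys) \<star> (cl_prod xs \<star> cl_prod (rev xs))"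
      using unit_word_inverse assms by simp
    also have "\<dots> = (cl_prod (rev ys) \<star> cl_prod ys) \<star> cl_prod (rev xs)"
      by (simp only: cl_mult_assoc ys(2))
    also have "\<dots> = cl_prod (rev xs)"
      using unit_word_inverse ys(1) by simp
    finally show "cl_vec (matrix (foldr reflect xs) *v y) = cl_prod ys \<star> cl_vec y \<star> cl_prod (rev ys)"
      using ys(2) cl_prod_sandwich[OF unit_wordD[OF assms], of y] by (simp add: matrix_foldr_reflect)
  qed
next
  fix M assume "\<forall>ys. unit_word ys \<and> cl_prod xs = cl_prod ys \<longrightarrow>
     (\<forall>y. cl_vec (M *v y) = cl_prod ys \<star> cl_vec y \<star> cl_prod (rev ys))"
  then have "cl_vec (M *v y) = cl_vec (matrix (foldr reflect xs) *v y)" for y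
    using assms cl_prod_sandwich[OF unit_wordD[OF assms], of y] by (simp add: matrix_foldr_reflect)
  then show "M = matrix (foldr reflect xs)"
    using inj_cl_vec by (simp add: matrix_eq inj_eq)
qed

lemma lambda8_intertwines:
  assumes "g \<in> carrier Spin8"
  shows "g \<star> cl_vec y = cl_vec (lambda8 g *v y) \<star> g"
proof -
  obtain xs where xs: "unit_word xs" "g = cl_prod xs"
    using assms SpinE by blast
  then have "cl_vec (lambda8 g *v y) \<star> g = cl_prod xs \<star> cl_vec y \<star> (cl_prod (rev xs) \<star> cl_prod xs)"
    using cl_prod_sandwich[OF unit_wordD[OF xs(1)], of y]
    by (simp add: lambda8_word matrix_foldr_reflect cl_mult_assoc flip: cl_mult_assoc)
  then show ?thesis
    using unit_word_inverse xs by simp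
qed

lemma lambda8_unique:
  assumes "g \<in> carrier Spin8" "g \<star> cl_vec y = cl_vec z \<star> g"
  shows "lambda8 g *v y = z"
proof -
  obtain h where h: "g \<star> h = cl_one"
    using assms Spin_inverse by blast
  have "cl_vec z = (cl_vec z \<star> g) \<star> h"
    by (simp add: cl_mult_assoc h)
  also have "\<dots> = cl_vec (lambda8 g *v y) \<star> (g \<star> h)"
    using assms lambda8_intertwines by (metis cl_mult_assoc)
  finally show ?thesis
    using inj_cl_vec h by (simp add: inj_eq)
qed

lemma lambda8_mult:
  assumes "g \<in> carrier Spin8" "h \<in> carrier Spin8"
  shows "lambda8 (g \<star> h) = lambda8 g ** lambda8 h"
proof -
  have "(g \<star> h) \<star> cl_vec y = cl_vec (lambda8 g *v (lambda8 h *v y)) \<star> (g \<star> h)" for y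
    using assms by (metis lambda8_intertwines cl_mult_assoc)
  then show ?thesis
    using lambda8_unique[OF Spin_mult[OF assms]] by (simp add: matrix_eq matrix_vector_mul_assoc)
qed

lemma orthogonal_lambda8:
  assumes "g \<in> carrier Spin8"
  shows "orthogonal_matrix (lambda8 g)"
proof -
  obtain xs where xs: "unit_word xs" "g = cl_prod xs"
    using assms SpinE by blast
  then show ?thesis
    using orthogonal_transformation_foldr_reflect[OF unit_wordD[OF xs(1)]]
    by (simp add: lambda8_word orthogonal_transformation_matrix)
qed

text \<open>The determinant is \<open>1\<close> or \<open>-1\<close>, hence \<open>1\<close> on squares.\<close>

lemma orthogonal_representation_special:
  fixes f :: "cl8 \<Rightarrow> real^8^8"
  assumes "\<And>g. g \<in> carrier Spin8 \<Longrightarrow> orthogonal_matrix (f g)"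
    and "\<And>g h. g \<in> carrier Spin8 \<Longrightarrow> h \<in> carrier Spin8 \<Longrightarrow> f (g \<star> h) = f g ** f h"
    and "g \<in> carrier Spin8"
  shows "det (f g) = 1"
  using assms(3)
proof (induction rule: Spin_square_induct)
  case one
  have "f cl_one = f cl_one ** f cl_one"
    using assms(2)[OF Spin_one Spin_one] by simp
  moreover have "det (f cl_one) \<noteq> 0"
    using det_orthogonal_matrix[OF assms(1)[OF Spin_one]] by auto
  ultimately show ?case
    by (metis det_mul mult_cancel_right1)
next
  case (square h)
  then show ?case
    using det_orthogonal_matrix[OF assms(1), of h] assms(2) by (auto simp: det_mul)
next
  case (mult g h)
  then show ?case
    using assms(2) by (simp add: det_mul)
qed

lemma orthogonal_representation_hom:
  fixes f :: "cl8 \<Rightarrow> real^8^8"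
  assumes "\<And>g. g \<in> carrier Spin8 \<Longrightarrow> orthogonal_matrix (f g)"
    and "\<And>g h. g \<in> carrier Spin8 \<Longrightarrow> h \<in> carrier Spin8 \<Longrightarrow> f (g \<star> h) = f g ** f h"
  shows "f \<in> hom Spin8 SO8"
  using assms orthogonal_representation_special[OF assms]
  by (auto simp: hom_def SO8_def rotation_matrix_def)

lemma lambda8_hom: "lambda8 \<in> hom Spin8 SO8"
  using orthogonal_lambda8 lambda8_mult by (rule orthogonal_representation_hom)

text \<open>The product of two reflections lies in the image of \<open>lambda8\<close> and has determinant \<open>1\<close>, so all reflections have
the same determinant.  The one in the first axis is diagonal.\<close>

lemma det_reflect:
  assumes "norm x = 1"
  shows "det (matrix (reflect x)) = -1"
proof -
  let ?e = "axis 1 1 :: real^8"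
  have entries: "matrix (reflect ?e) $ i $ j = (if i = j then if i = 1 then -1 else 1 else 0)" for i j
    by (simp add: matrix_def reflect_def inner_axis_axis, simp add: axis_def)
  have "det (matrix (reflect ?e)) = -1"
    by (subst det_diagonal) (simp_all add: entries)
  moreover have word: "unit_word [x, ?e]"
    using assms by (simp add: unit_word_def)
  then have "det (lambda8 (cl_prod [x, ?e])) = 1"
    by (intro orthogonal_representation_special[of lambda8] orthogonal_lambda8 lambda8_mult SpinI)
  then have "det (matrix (reflect x)) * det (matrix (reflect ?e)) = 1"
    unfolding lambda8_word[OF word]
    by (simp add: matrix_compose linear_reflect flip: det_mul)
  ultimately show ?thesis by simp
qed

text \<open>A rotation is a product of reflections, and its determinant makes their number even.\<close>

theorem lambda8_surj:
  assumes "rotation_matrix M"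
  obtains g where "g \<in> carrier Spin8" "lambda8 g = M"
proof -
  have "orthogonal_transformation ((*v) M)"
    using assms by (simp add: rotation_matrix_def orthogonal_transformation_matrix)
  then obtain xs where xs: "\<forall>x\<in>set xs. norm x = 1" "(*v) M = foldr reflect xs"
    by (rule orthogonal_is_product_of_reflections)
  then have M: "M = matrix (foldr reflect xs)"
    by (metis matrix_of_matrix_vector_mul)
  have "det (matrix (foldr reflect xs)) = (-1) ^ length xs"
    using xs(1)
  proof (induction xs)
    case Nil
    then show ?case by (simp add: matrix_id_mat_1 flip: id_def)
  next
    case (Cons x xs)
    have step: "matrix (foldr reflect (x # xs)) = matrix (reflect x) ** matrix (foldr reflect xs)"
      by (simp only: foldr_Cons matrix_compose linear_reflect linear_foldr_reflect)
    show ?case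
      unfolding step using Cons by (simp add: det_mul det_reflect)
  qed
  then have "even (length xs)"
    using M assms by (auto simp: rotation_matrix_def minus_one_power_iff split: if_splits)
  then have "unit_word xs"
    using xs by (simp add: unit_word_def)
  then show ?thesis
    using M by (intro that[of "cl_prod xs"]) (simp_all add: SpinI lambda8_word)
qed

section \<open>Half-spinors as octonions\<close>

lemma exhaust_16:
  fixes x :: 16
  shows "x = 0 \<or> x = 1 \<or> x = 2 \<or> x = 3 \<or> x = 4 \<or> x = 5 \<or> x = 6 \<or> x = 7 \<or> x = 8 \<or>
    x = 9 \<or> x = 10 \<or> x = 11 \<or> x = 12 \<or> x = 13 \<or> x = 14 \<or> x = 15"
proof (induct x)
  case (of_int z)
  then have "z = 0 \<or> z = 1 \<or> z = 2 \<or> z = 3 \<or> z = 4 \<or> z = 5 \<or> z = 6 \<or> z = 7 \<or> z = 8 \<or>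
      z = 9 \<or> z = 10 \<or> z = 11 \<or> z = 12 \<or> z = 13 \<or> z = 14 \<or> z = 15"
    by simp arith
  then show ?case by auto
qed

lemma forall_16: "(\<forall>i::16. P i) \<longleftrightarrow> P 0 \<and> P 1 \<and> P 2 \<and> P 3 \<and> P 4 \<and> P 5 \<and> P 6 \<and> P 7 \<and> P 8 \<and>
    P 9 \<and> P 10 \<and> P 11 \<and> P 12 \<and> P 13 \<and> P 14 \<and> P 15"
  by (metis exhaust_16)

lemma lessThan_16: "{..<16::nat} = {0,1,2,3,4,5,6,7,8,9,10,11,12,13,14,15}"
  by (auto; presburger)

lemma lessThan_small: "{..<2::nat} = {0,1}" "{..<3::nat} = {0,1,2}" "{..<4::nat} = {0,1,2,3}"
  by auto

text \<open>Arithmetic form of the bit operation, which the simplifier can evaluate on numerals.\<close>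

lemma flip_bit_nat: "flip_bit n (a :: nat) = (if even (a div 2 ^ n) then a + 2 ^ n else a - 2 ^ n)"
proof (cases "bit a n")
  case True
  have "a = set_bit n (unset_bit n a)"
    by (rule bit_eqI) (use True in \<open>auto simp: bit_simps\<close>)
  also have "\<dots> = unset_bit n a + 2 ^ n"
    by (simp add: set_bit_eq bit_simps)
  finally show ?thesis
    using True by (simp add: flip_bit_eq_if bit_iff_odd)
qed (simp add: flip_bit_eq_if bit_iff_odd set_bit_eq)

lemma interval_8: "{1..8::nat} = {1,2,3,4,5,6,7,8}"
  by auto

lemma half_spinor_nth:
  "half_spinor bs y $ b = y $ 1 *\<^sub>R ((bs ! 0) $ b) + y $ 2 *\<^sub>R ((bs ! 1) $ b) + y $ 3 *\<^sub>R ((bs ! 2) $ b)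
    + y $ 4 *\<^sub>R ((bs ! 3) $ b) + y $ 5 *\<^sub>R ((bs ! 4) $ b) + y $ 6 *\<^sub>R ((bs ! 5) $ b)
    + y $ 7 *\<^sub>R ((bs ! 6) $ b) + y $ 8 *\<^sub>R ((bs ! 7) $ b)"
  unfolding half_spinor_def interval_8 by simp

lemmas dirac_evaluation = dirac_def lessThan_16 dirac_basis_def Let_def digit_def lessThan_small
  flip_bit_nat uvec_def axis_def half_spinor_nth plus_basis_def minus_basis_def
  vec_eq_iff forall_16 oct_nth oconj_nth

text \<open>The structure constants of \<open>oct\<close> are compared with the action of the generators on spinors, coordinate by
coordinate for each of the eight generators.\<close>

lemma dirac_half_plus:
  assumes "j \<in> {1..8}"
  shows "dirac j (half_spinor plus_basis y) = half_spinor minus_basis (oct (axis (of_nat j) 1) y)"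
  using assms unfolding interval_8
  by (elim insertE emptyE; simp add: dirac_evaluation; simp add: algebra_simps)

lemma dirac_half_minus:
  assumes "j \<in> {1..8}"
  shows "dirac j (half_spinor minus_basis y) = half_spinor plus_basis (- oct (oconj (axis (of_nat j) 1)) y)"
  using assms unfolding interval_8
  by (elim insertE emptyE; simp add: dirac_evaluation; simp add: algebra_simps)

lemma linear_half_spinor: "linear (half_spinor bs)"
  by (rule linearI) (simp_all add: half_spinor_def scaleR_sum_right sum.distrib algebra_simps)

lemma linear_dirac: "linear (dirac j)"
  by (rule linearI)
    (simp_all add: dirac_def vec_eq_iff sum.distrib algebra_simps scaleR_sum_right)

lemma inj_half_spinor_plus: "inj (half_spinor plus_basis)"
proof -
  have "y = 0" if "half_spinor plus_basis y = 0" for y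
  proof -
    have "\<forall>b. half_spinor plus_basis y $ b = 0"
      using that by simp
    then show ?thesis
      by (simp add: forall_16 half_spinor_nth plus_basis_def uvec_def axis_def complex_eq_iff
          vec_eq_iff forall_8)
  qed
  then show ?thesis
    by (simp add: linear_injective_0[OF linear_half_spinor])
qed

lemma inj_half_spinor_minus: "inj (half_spinor minus_basis)"
proof -
  have "y = 0" if "half_spinor minus_basis y = 0" for y
  proof -
    have "\<forall>b. half_spinor minus_basis y $ b = 0"
      using that by simp
    then show ?thesis
      by (simp add: forall_16 half_spinor_nth minus_basis_def uvec_def axis_def complex_eq_iff
          vec_eq_iff forall_8)
  qed
  then show ?thesis
    by (simp add: linear_injective_0[OF linear_half_spinor])
qed

text \<open>The two real half-spinor spaces span a real form of the complex spinors, which has pairs of octonions as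
coordinates.\<close>

definition real_spinor :: "(real^8) \<times> (real^8) \<Rightarrow> spinor" where
  "real_spinor w = half_spinor plus_basis (fst w) + half_spinor minus_basis (snd w)"

lemma linear_real_spinor: "linear real_spinor"
  by (rule linearI) (simp_all add: real_spinor_def linear_add[OF linear_half_spinor]
      linear_scale[OF linear_half_spinor] algebra_simps)

lemma dirac_real_spinor:
  assumes "j \<in> {1..8}"
  shows "dirac j (real_spinor w) = real_spinor (axis_op j w)"
  using assms by (simp only: real_spinor_def linear_add[OF linear_dirac] dirac_half_plus
      dirac_half_minus dirac_op_def fst_conv snd_conv add.commute)

lemma cl_act_real_spinor: "cl_act g (real_spinor w) = real_spinor (act g w)"
proof -
  have fold: "foldr dirac js (real_spinor w) = real_spinor (foldr axis_op js w)"
    if "set js \<subseteq> {1..8}" for js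
    using that by (induction js) (simp_all only: foldr.simps id_apply comp_apply list.set insert_subset dirac_real_spinor simp_thms)
  have "foldr dirac (sorted_list_of_set (labels A)) (real_spinor w) = real_spinor (word_op (labels A) w)" for A
    unfolding word_op_def by (rule fold) (simp only: finite_labels set_sorted_list_of_set labels_subset)
  then show ?thesis
    by (simp add: cl_act_def act_def linear_sum[OF linear_real_spinor] linear_scale[OF linear_real_spinor])
qed

section \<open>The half-spin representations\<close>

lemma act_cl_prod: "act (cl_prod xs) w = foldr dirac_op xs w"
  by (induction xs) (simp_all add: act_mult act_vec)

text \<open>Each vector exchanges the two half-spinor spaces.\<close>

lemma act_parity:
  "even (length xs) \<Longrightarrow> snd (act (cl_prod xs) (y, 0)) = 0 \<and> fst (act (cl_prod xs) (0, y)) = 0"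
  "odd (length xs) \<Longrightarrow> fst (act (cl_prod xs) (y, 0)) = 0 \<and> snd (act (cl_prod xs) (0, y)) = 0"
proof -
  have z: "oct x 0 = 0" for x
    using oct_linear(4)[of x 0 0] by simp
  have "(even (length xs) \<longrightarrow> snd (act (cl_prod xs) (y, 0)) = 0 \<and> fst (act (cl_prod xs) (0, y)) = 0) \<and>
    (odd (length xs) \<longrightarrow> fst (act (cl_prod xs) (y, 0)) = 0 \<and> snd (act (cl_prod xs) (0, y)) = 0)"
    unfolding act_cl_prod by (induction xs) (auto simp: dirac_op_def z)
  then show "even (length xs) \<Longrightarrow> snd (act (cl_prod xs) (y, 0)) = 0 \<and> fst (act (cl_prod xs) (0, y)) = 0"
    "odd (length xs) \<Longrightarrow> fst (act (cl_prod xs) (y, 0)) = 0 \<and> snd (act (cl_prod xs) (0, y)) = 0"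
    by auto
qed

lemma kappa_eq_matrix:
  assumes "linear f" "inj (half_spinor bs)"
    and "\<And>y. cl_act g (half_spinor bs y) = half_spinor bs (f y)"
  shows "kappa bs g = matrix f"
  unfolding kappa_def
proof (rule the_equality)
  fix M assume "\<forall>y. half_spinor bs (M *v y) = cl_act g (half_spinor bs y)"
  then show "M = matrix f"
    using assms by (simp add: matrix_eq matrix_works inj_eq)
qed (simp add: assms matrix_works)

lemma kappa_plus_apply:
  assumes "g \<in> carrier Spin8"
  shows "act g (y, 0) = (kappa_plus g *v y, 0)"
proof -
  define f where "f y = fst (act g (y, 0))" for y
  obtain xs where xs: "unit_word xs" "g = cl_prod xs"
    using assms SpinE by blast
  then have act: "act g (y, 0) = (f y, 0)" for y
    using act_parity(1)[of xs y] by (simp add: f_def unit_word_def prod_eq_iff)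
  have "linear f"
  proof (rule linearI)
    show "f (x + y) = f x + f y" for x y
      using linear_add[OF linear_act, of g "(x, 0)" "(y, 0)"] by (simp add: f_def)
    show "f (c *\<^sub>R y) = c *\<^sub>R f y" for c y
      using linear_scale[OF linear_act, of g c "(y, 0)"] by (simp add: f_def)
  qed
  have spinor: "cl_act g (half_spinor plus_basis y) = half_spinor plus_basis (f y)" for y
    using cl_act_real_spinor[of g "(y, 0)"]
    by (simp add: real_spinor_def act linear_0[OF linear_half_spinor])
  have "kappa_plus g = matrix f"
    unfolding kappa_plus_def using \<open>linear f\<close> inj_half_spinor_plus spinor by (rule kappa_eq_matrix)
  then show ?thesis
    by (simp add: act matrix_works \<open>linear f\<close>)
qed

lemma kappa_minus_apply:
  assumes "g \<in> carrier Spin8"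
  shows "act g (0, y) = (0, kappa_minus g *v y)"
proof -
  define f where "f y = snd (act g (0, y))" for y
  obtain xs where xs: "unit_word xs" "g = cl_prod xs"
    using assms SpinE by blast
  then have act: "act g (0, y) = (0, f y)" for y
    using act_parity(1)[of xs y] by (simp add: f_def unit_word_def prod_eq_iff)
  have "linear f"
  proof (rule linearI)
    show "f (x + y) = f x + f y" for x y
      using linear_add[OF linear_act, of g "(0, x)" "(0, y)"] by (simp add: f_def)
    show "f (c *\<^sub>R y) = c *\<^sub>R f y" for c y
      using linear_scale[OF linear_act, of g c "(0, y)"] by (simp add: f_def)
  qed
  have spinor: "cl_act g (half_spinor minus_basis y) = half_spinor minus_basis (f y)" for y
    using cl_act_real_spinor[of g "(0, y)"]
    by (simp add: real_spinor_def act linear_0[OF linear_half_spinor])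
  have "kappa_minus g = matrix f"
    unfolding kappa_minus_def using \<open>linear f\<close> inj_half_spinor_minus spinor by (rule kappa_eq_matrix)
  then show ?thesis
    by (simp add: act matrix_works \<open>linear f\<close>)
qed

lemma act_Spin:
  assumes "g \<in> carrier Spin8"
  shows "act g (y, z) = (kappa_plus g *v y, kappa_minus g *v z)"
  using linear_add[OF linear_act, of g "(y, 0)" "(0, z)"]
  by (simp add: kappa_plus_apply kappa_minus_apply assms)

lemma kappa_mult:
  assumes "g \<in> carrier Spin8" "h \<in> carrier Spin8"
  shows "kappa_plus (g \<star> h) = kappa_plus g ** kappa_plus h"
    "kappa_minus (g \<star> h) = kappa_minus g ** kappa_minus h"
proof -
  have "(kappa_plus (g \<star> h) *v y, kappa_minus (g \<star> h) *v y)
      = (kappa_plus g *v (kappa_plus h *v y), kappa_minus g *v (kappa_minus h *v y))" for y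
    using act_mult[of g h "(y, y)"] by (simp only: act_Spin Spin_mult assms)
  then show "kappa_plus (g \<star> h) = kappa_plus g ** kappa_plus h"
    "kappa_minus (g \<star> h) = kappa_minus g ** kappa_minus h"
    by (simp_all add: matrix_eq matrix_vector_mul_assoc)
qed

lemma norm_act_Spin:
  assumes "g \<in> carrier Spin8"
  shows "norm (act g w) = norm w"
proof -
  obtain xs where xs: "unit_word xs" "g = cl_prod xs"
    using assms SpinE by blast
  have "norm (foldr dirac_op xs w) = norm w"
    using unit_wordD[OF xs(1)] by (induction xs) (simp_all add: norm_dirac_op)
  then show ?thesis
    by (simp add: xs(2) act_cl_prod)
qed

lemma orthogonal_kappa:
  assumes "g \<in> carrier Spin8"
  shows "orthogonal_matrix (kappa_plus g)" "orthogonal_matrix (kappa_minus g)"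
proof -
  have "norm (kappa_plus g *v y) = norm y" "norm (kappa_minus g *v y) = norm y" for y
    using norm_act_Spin[OF assms, of "(y, 0)"] norm_act_Spin[OF assms, of "(0, y)"]
    by (simp_all add: kappa_plus_apply kappa_minus_apply assms norm_Pair)
  then show "orthogonal_matrix (kappa_plus g)" "orthogonal_matrix (kappa_minus g)"
    using orthogonal_transformation_matrix[of "(*v) (kappa_plus g)"]
      orthogonal_transformation_matrix[of "(*v) (kappa_minus g)"]
    by (simp_all add: orthogonal_transformation)
qed

lemma kappa_plus_hom: "kappa_plus \<in> hom Spin8 SO8"
  using orthogonal_kappa(1) kappa_mult(1) by (rule orthogonal_representation_hom)

lemma kappa_minus_hom: "kappa_minus \<in> hom Spin8 SO8"
  using orthogonal_kappa(2) kappa_mult(2) by (rule orthogonal_representation_hom)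

text \<open>By faithfulness an element is determined by its action on the two half-spinor spaces.\<close>

lemma Spin_eqI:
  assumes "g \<in> carrier Spin8" "h \<in> carrier Spin8"
    "kappa_plus g = kappa_plus h" "kappa_minus g = kappa_minus h"
  shows "g = h"
proof -
  have "act (g - h) w = 0" for w
    using assms by (cases w) (simp add: linear_diff[OF linear_act_left] act_Spin)
  then have "g - h = 0"
    by (rule act_faithful)
  then show ?thesis by simp
qed

lemma matrix_vector_mult_minus: "(- A) *v x = - (A *v x)" for A :: "real^'n^'m"
  by (simp add: matrix_vector_mult_def vec_eq_iff sum_negf)

lemma Spin_minus_representations:
  assumes "g \<in> carrier Spin8"
  shows "lambda8 (- g) = lambda8 g" "kappa_plus (- g) = - kappa_plus g" "kappa_minus (- g) = - kappa_minus g"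
proof -
  note minus = Spin_minus[OF assms]
  have "lambda8 (- g) *v y = lambda8 g *v y" for y
    using minus by (rule lambda8_unique) (simp add: lambda8_intertwines assms)
  then show "lambda8 (- g) = lambda8 g"
    by (simp add: matrix_eq)
  have "(kappa_plus (- g) *v y, kappa_minus (- g) *v y) = - (kappa_plus g *v y, kappa_minus g *v y)" for y
    using linear_neg[OF linear_act_left, of g "(y, y)"] by (simp only: act_Spin minus assms)
  then show "kappa_plus (- g) = - kappa_plus g" "kappa_minus (- g) = - kappa_minus g"
    by (simp_all add: matrix_eq matrix_vector_mult_minus)
qed

text \<open>The equation \<open>g x = (lambda8 g x) g\<close> of the Clifford algebra, applied to a positive half-spinor.\<close>

theorem triality:
  assumes "g \<in> carrier Spin8"
  shows "kappa_minus g *v oct x y = oct (lambda8 g *v x) (kappa_plus g *v y)"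
proof -
  have z: "oct x 0 = 0" for x
    using oct_linear(4)[of x 0 0] by simp
  have "act g (act (cl_vec x) (y, 0)) = act (cl_vec (lambda8 g *v x)) (act g (y, 0))"
    using lambda8_intertwines[OF assms, of x] by (metis act_mult)
  then show ?thesis
    using assms by (simp add: act_vec dirac_op_def z kappa_plus_apply kappa_minus_apply)
qed

section \<open>Triality\<close>

text \<open>Conjugation by \<open>oconj\<close>, which up to sign is the reflection in the first axis.\<close>

definition conj_twist :: "real^8^8 \<Rightarrow> real^8^8" where
  "conj_twist A = matrix (\<lambda>y. oconj (A *v oconj y))"

lemma conj_twist_apply: "conj_twist A *v y = oconj (A *v oconj y)"
proof -
  have "linear (\<lambda>y. oconj (A *v oconj y))"
    by (rule linearI) (simp_all add: oconj_linear matrix_vector_right_distrib matrix_vector_mult_scaleR)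
  then show ?thesis
    by (simp add: conj_twist_def matrix_works)
qed

lemma conj_twist_conj_twist [simp]: "conj_twist (conj_twist A) = A"
  by (simp add: matrix_eq conj_twist_apply)

lemma orthogonal_conj_twist:
  assumes "orthogonal_matrix A"
  shows "orthogonal_matrix (conj_twist A)"
proof -
  have "orthogonal_transformation ((*v) A)"
    using assms by (simp add: orthogonal_transformation_matrix)
  then have "orthogonal_transformation ((*v) (conj_twist A))"
    unfolding orthogonal_transformation_def by (simp add: conj_twist_apply inner_oconj)
  then show ?thesis
    by (simp add: orthogonal_transformation_matrix)
qed

lemma triality_swap:
  assumes "g \<in> carrier Spin8"
  shows "conj_twist (kappa_minus g) *v oct x y = oct (kappa_plus g *v x) (lambda8 g *v y)"
  using triality[OF assms, of y x] by (simp add: conj_twist_apply oconj_oct)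

lemma orthogonal_matrix_cancel:
  assumes "orthogonal_matrix A"
  shows "A *v (transpose A *v x) = x" "transpose A *v (A *v x) = x"
  using assms by (simp_all add: orthogonal_matrix_def matrix_vector_mul_assoc)

text \<open>Compare the two solutions by \<open>X = B\<inverse> B'\<close> and \<open>Y = C\<inverse> C'\<close>.  The relations give
\<open>Y (oct x y) = oct x (X y)\<close>, and \<open>x = 1\<close> gives \<open>X = Y\<close>.  So \<open>X\<close> commutes with all left multiplications and is a
scalar, which is \<open>1\<close> or \<open>-1\<close> because \<open>B\<close> and \<open>B'\<close> are orthogonal.\<close>

lemma triality_determined:
  assumes orth: "orthogonal_matrix B" "orthogonal_matrix C" "orthogonal_matrix B'"
    and BC: "\<And>x y. C *v oct x y = oct (A *v x) (B *v y)"
    and BC': "\<And>x y. C' *v oct x y = oct (A *v x) (B' *v y)"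
  shows "(B' = B \<and> C' = C) \<or> (B' = - B \<and> C' = - C)"
proof -
  define X where "X = (\<lambda>y. transpose B *v (B' *v y))"
  define Y where "Y = (\<lambda>y. transpose C *v (C' *v y))"
  have X: "B' *v y = B *v X y" and Y: "C' *v y = C *v Y y" for y
    by (simp_all only: X_def Y_def orthogonal_matrix_cancel(1)[OF orth(1)]
        orthogonal_matrix_cancel(1)[OF orth(2)])
  have "C *v Y (oct x y) = C *v oct x (X y)" for x y
    using BC' by (simp add: BC flip: X Y)
  then have YX: "Y (oct x y) = oct x (X y)" for x y
    by (metis orth(2) orthogonal_matrix_cancel(2))
  then have "Y = X"
    by (metis oct_one ext)
  obtain c where c: "\<And>y. X y = c *\<^sub>R y"
    using commutant[of X] YX \<open>Y = X\<close> by auto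
  have "orthogonal_transformation ((*v) B)" "orthogonal_transformation ((*v) B')"
    using orth by (simp_all add: orthogonal_transformation_matrix)
  then have "norm (X y) = norm y" for y
    using X by (metis orthogonal_transformation_norm)
  from this[of "axis 1 1"] have "c = 1 \<or> c = -1"
    by (auto simp: c)
  then show ?thesis
  proof
    assume "c = 1"
    then show ?thesis
      using X Y c \<open>Y = X\<close> by (simp add: matrix_eq)
  next
    assume "c = -1"
    then have "B' = - B" "C' = - C"
      using X Y c \<open>Y = X\<close>
      by (simp_all add: matrix_eq matrix_vector_mult_minus linear_neg[OF matrix_vector_mul_linear])
    then show ?thesis
      by blast
  qed
qed

text \<open>Two elements with the same image give two solutions of the triality relation with the same first component.\<close>

theorem lambda8_kernel:
  assumes "g \<in> carrier Spin8" "h \<in> carrier Spin8" "lambda8 g = lambda8 h"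
  shows "g = h \<or> g = - h"
proof -
  have "(kappa_plus g = kappa_plus h \<and> kappa_minus g = kappa_minus h) \<or>
      (kappa_plus g = - kappa_plus h \<and> kappa_minus g = - kappa_minus h)"
    by (rule triality_determined[of _ _ _ "lambda8 h"])
      (simp_all add: orthogonal_kappa assms triality flip: assms(3))
  then show ?thesis
    using Spin_eqI[OF assms(1,2)] Spin_eqI[OF assms(1) Spin_minus[OF assms(2)]]
      Spin_minus_representations[OF assms(2)] by auto
qed

text \<open>Surjectivity of \<open>lambda8\<close> gives an element over \<open>kappa_plus g\<close>.  Its triple and the swapped triple of \<open>g\<close> solve the
triality relation with the same first component, so they agree up to a sign that the element can absorb.\<close>

theorem triality_swap_exists:
  assumes g: "g \<in> carrier Spin8"
  obtains h where "h \<in> carrier Spin8" "lambda8 h = kappa_plus g" "kappa_plus h = lambda8 g"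
    "kappa_minus h = conj_twist (kappa_minus g)"
proof -
  have "rotation_matrix (kappa_plus g)"
    using kappa_plus_hom g by (auto simp: hom_def SO8_def)
  then obtain h where h: "h \<in> carrier Spin8" "lambda8 h = kappa_plus g"
    by (rule lambda8_surj)
  have "(kappa_plus h = lambda8 g \<and> kappa_minus h = conj_twist (kappa_minus g)) \<or>
      (kappa_plus h = - lambda8 g \<and> kappa_minus h = - conj_twist (kappa_minus g))"
    using triality[OF h(1)] h triality_swap[OF g] g
    by (intro triality_determined[of _ _ _ "kappa_plus g"])
      (auto simp: orthogonal_kappa orthogonal_lambda8 orthogonal_conj_twist)
  then show ?thesis
  proof
    assume "kappa_plus h = lambda8 g \<and> kappa_minus h = conj_twist (kappa_minus g)"
    then show ?thesis
      using h that by blast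
  next
    assume "kappa_plus h = - lambda8 g \<and> kappa_minus h = - conj_twist (kappa_minus g)"
    then show ?thesis
      using h by (intro that[of "- h"]) (simp_all add: Spin_minus Spin_minus_representations)
  qed
qed

text \<open>The description names the element by its half-spin representations, which determine it.\<close>

definition swap_aut :: "cl8 \<Rightarrow> cl8" where
  "swap_aut = (\<lambda>g\<in>carrier Spin8. THE h. h \<in> carrier Spin8 \<and> kappa_plus h = lambda8 g \<and>
     kappa_minus h = conj_twist (kappa_minus g))"

lemma swap_aut:
  assumes "g \<in> carrier Spin8"
  shows "swap_aut g \<in> carrier Spin8" "lambda8 (swap_aut g) = kappa_plus g"
    "kappa_plus (swap_aut g) = lambda8 g" "kappa_minus (swap_aut g) = conj_twist (kappa_minus g)"
proof -
  obtain h where h: "h \<in> carrier Spin8" "lambda8 h = kappa_plus g" "kappa_plus h = lambda8 g"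
      "kappa_minus h = conj_twist (kappa_minus g)"
    using triality_swap_exists[OF assms] by metis
  have "swap_aut g = h"
    unfolding swap_aut_def using assms h
    by (auto intro!: the_equality intro: Spin_eqI)
  then show "swap_aut g \<in> carrier Spin8" "lambda8 (swap_aut g) = kappa_plus g"
    "kappa_plus (swap_aut g) = lambda8 g" "kappa_minus (swap_aut g) = conj_twist (kappa_minus g)"
    using h by simp_all
qed

text \<open>Conjugation by \<open>e\<^sub>1\<close>, whose inverse is \<open>- e\<^sub>1\<close>.\<close>

definition pin_aut :: "cl8 \<Rightarrow> cl8" where
  "pin_aut = (\<lambda>g\<in>carrier Spin8. cl_vec (axis 1 1) \<star> g \<star> - cl_vec (axis 1 1))"

text \<open>The first representation is twisted because \<open>e\<^sub>1 x e\<^sub>1 = - conj(x)\<close>.  The half-spin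
representations are exchanged because \<open>e\<^sub>1\<close> maps each half-spinor space to the other, with the matrix \<open>1\<close> or \<open>-1\<close>.\<close>

lemma pin_aut:
  assumes "g \<in> carrier Spin8"
  shows "pin_aut g \<in> carrier Spin8" "lambda8 (pin_aut g) = conj_twist (lambda8 g)"
    "kappa_plus (pin_aut g) = kappa_minus g" "kappa_minus (pin_aut g) = kappa_plus g"
proof -
  let ?e = "axis 1 1 :: real^8" and ?E = "cl_vec (axis 1 1)"
  have ag: "pin_aut g = ?E \<star> g \<star> - ?E"
    using assms by (simp add: pin_aut_def)
  have EE: "?E \<star> ?E = - cl_one"
    by (simp add: cl_vec_square)
  then have EEx: "?E \<star> (?E \<star> x) = - x" for x
    by (metis cl_mult_assoc cl_mult_minus(1) cl_one_mult)
  obtain xs where xs: "unit_word xs" "g = cl_prod xs"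
    using assms SpinE by blast
  have "unit_word (?e # xs @ [- ?e])"
    using xs(1) by (auto simp: unit_word_def)
  moreover have "cl_prod (?e # xs @ [- ?e]) = pin_aut g"
    unfolding ag unfolding xs(2) by (simp add: linear_neg[OF linear_cl_vec] cl_mult_assoc)
  ultimately show carrier: "pin_aut g \<in> carrier Spin8"
    by (metis SpinI)
  have conj: "?E \<star> cl_vec x \<star> ?E = - cl_vec (oconj x)" for x
  proof -
    have "reflect ?e x = - oconj x"
      by (simp add: reflect_def vec_eq_iff oconj_nth inner_axis' , simp add: axis_def)
    then show ?thesis
      by (simp add: cl_vec_reflect linear_neg[OF linear_cl_vec])
  qed
  have "lambda8 (pin_aut g) *v x = conj_twist (lambda8 g) *v x" for x
  proof (rule lambda8_unique[OF carrier])
    have "pin_aut g \<star> cl_vec x = - (?E \<star> g \<star> ?E \<star> cl_vec x)"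
      by (simp add: ag)
    also have "\<dots> = ?E \<star> (g \<star> (?E \<star> cl_vec x \<star> ?E)) \<star> ?E"
      by (simp add: cl_mult_assoc EE)
    also have "\<dots> = - (?E \<star> (cl_vec (lambda8 g *v oconj x) \<star> g) \<star> ?E)"
      unfolding conj by (simp add: lambda8_intertwines assms)
    also have "\<dots> = (?E \<star> cl_vec (lambda8 g *v oconj x) \<star> ?E) \<star> (?E \<star> g \<star> ?E)"
      by (simp add: cl_mult_assoc EEx)
    also have "\<dots> = cl_vec (conj_twist (lambda8 g) *v x) \<star> pin_aut g"
      unfolding conj ag by (simp add: conj_twist_apply)
    finally show "pin_aut g \<star> cl_vec x = cl_vec (conj_twist (lambda8 g) *v x) \<star> pin_aut g" .
  qed
  then show "lambda8 (pin_aut g) = conj_twist (lambda8 g)"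
    by (simp add: matrix_eq)
  have e: "oconj ?e = ?e"
    by (simp add: vec_eq_iff oconj_nth axis_def)
  have "(kappa_plus (pin_aut g) *v y, kappa_minus (pin_aut g) *v y)
      = (kappa_minus g *v y, kappa_plus g *v y)" for y
  proof -
    have "(kappa_plus (pin_aut g) *v y, kappa_minus (pin_aut g) *v y)
        = - dirac_op ?e (act g (dirac_op ?e (y, y)))"
      unfolding act_Spin[OF carrier, symmetric] unfolding ag
      by (simp add: act_mult act_vec linear_neg[OF linear_act_left] linear_neg[OF linear_act]
          linear_neg[OF linear_dirac_op])
    also have "\<dots> = (kappa_minus g *v y, kappa_plus g *v y)"
      using linear_neg[OF matrix_vector_mul_linear, of "kappa_plus g" y]
      by (simp add: dirac_op_def oct_one e act_Spin assms)
    finally show ?thesis .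
  qed
  then show "kappa_plus (pin_aut g) = kappa_minus g" "kappa_minus (pin_aut g) = kappa_plus g"
    by (simp_all add: matrix_eq)
qed

section \<open>Lifts through the double covering\<close>

text \<open>Two homomorphic lifts of the same representation agree up to sign at every element by \<open>lambda8_kernel\<close>, hence
they agree on squares, and squares generate the group.\<close>

lemma spin_lift_eq:
  assumes "s \<in> extensional (carrier Spin8)" "s \<in> hom Spin8 Spin8" "continuous_on (carrier Spin8) s"
    and "\<And>g. g \<in> carrier Spin8 \<Longrightarrow> lambda8 (s g) = k g"
  shows "spin_lift k = s"
  unfolding spin_lift_def
proof (rule the_equality)
  fix s' assume s': "s' \<in> extensional (carrier Spin8) \<and> s' \<in> hom Spin8 Spin8 \<and>
     continuous_on (carrier Spin8) s' \<and> (\<forall>g\<in>carrier Spin8. lambda8 (s' g) = k g)"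
  have closed: "s g \<in> carrier Spin8" "s' g \<in> carrier Spin8" if "g \<in> carrier Spin8" for g
    using that assms(2) s' by (auto simp: hom_def)
  have mult: "s (g \<star> h) = s g \<star> s h" "s' (g \<star> h) = s' g \<star> s' h"
    if "g \<in> carrier Spin8" "h \<in> carrier Spin8" for g h
    using that assms(2) s' hom_mult[of s Spin8 Spin8] hom_mult[of s' Spin8 Spin8] by auto
  show "s' = s"
  proof (rule extensionalityI)
    fix g assume "g \<in> carrier Spin8"
    then show "s' g = s g"
    proof (induction rule: Spin_square_induct)
      case one
      have "s cl_one = cl_one" "s' cl_one = cl_one"
        using hom_one[OF assms(2) group_Spin8 group_Spin8] hom_one[of s' Spin8 Spin8] s' group_Spin8
        by auto
      then show ?case by simp
    next
      case (square h)
      then have "s' h = s h \<or> s' h = - s h"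
        using lambda8_kernel[of "s' h" "s h"] closed s' assms(4) by simp
      then show ?case
        using square by (auto simp: mult)
    qed (simp add: mult)
  qed (use assms s' in auto)
qed (use assms in auto)

lemma conj_twist_mult: "conj_twist (A ** B) = conj_twist A ** conj_twist B"
  by (simp add: matrix_eq conj_twist_apply flip: matrix_vector_mul_assoc)

lemma Spin_hom_by_kappa:
  assumes closed: "\<And>g. g \<in> carrier Spin8 \<Longrightarrow> s g \<in> carrier Spin8"
    and "\<And>g h. \<lbrakk>g \<in> carrier Spin8; h \<in> carrier Spin8\<rbrakk> \<Longrightarrow>
      kappa_plus (s (g \<star> h)) = kappa_plus (s g) ** kappa_plus (s h)"
    and "\<And>g h. \<lbrakk>g \<in> carrier Spin8; h \<in> carrier Spin8\<rbrakk> \<Longrightarrow>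
      kappa_minus (s (g \<star> h)) = kappa_minus (s g) ** kappa_minus (s h)"
  shows "s \<in> hom Spin8 Spin8"
proof (rule homI)
  fix g h assume "g \<in> carrier Spin8" "h \<in> carrier Spin8"
  then show "s (g \<otimes>\<^bsub>Spin8\<^esub> h) = s g \<otimes>\<^bsub>Spin8\<^esub> s h"
    using assms by (auto intro!: Spin_eqI simp: Spin_mult kappa_mult)
qed (rule closed)

lemma swap_aut_hom: "swap_aut \<in> hom Spin8 Spin8"
  by (rule Spin_hom_by_kappa)
    (simp_all add: swap_aut Spin_mult lambda8_mult kappa_mult conj_twist_mult)

lemma pin_aut_hom: "pin_aut \<in> hom Spin8 Spin8"
  by (rule Spin_hom_by_kappa) (simp_all add: pin_aut Spin_mult kappa_mult)

text \<open>Since the Clifford algebra acts faithfully, the linear map \<open>Q\<close> that sends an element to its action on the basis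
half-spinors has a linear left inverse \<open>L\<close>.  For \<open>s g\<close> in the group the entries of \<open>Q (s g)\<close> are columns of the two
matrices.\<close>

lemma continuous_by_kappa:
  assumes closed: "\<And>g. g \<in> carrier Spin8 \<Longrightarrow> s g \<in> carrier Spin8"
    and plus: "continuous_on (carrier Spin8) (\<lambda>g. kappa_plus (s g))"
    and minus: "continuous_on (carrier Spin8) (\<lambda>g. kappa_minus (s g))"
  shows "continuous_on (carrier Spin8) s"
proof -
  define Q :: "cl8 \<Rightarrow> ((((real^8) \<times> (real^8))^8) \<times> (((real^8) \<times> (real^8))^8))" where
    "Q x = (\<chi> k. act x (axis k 1, 0), \<chi> k. act x (0, axis k 1))" for x
  have lin: "linear Q"
    by (rule linearI) (simp_all add: Q_def vec_eq_iff linear_add[OF linear_act_left]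
        linear_scale[OF linear_act_left])
  have "inj Q"
  proof (subst linear_injective_0[OF lin], intro allI impI)
    fix x assume "Q x = 0"
    then have zero: "act x (axis k 1, 0) = 0" "act x (0, axis k 1) = 0" for k
      by (simp_all add: Q_def vec_eq_iff zero_prod_def)
    have "act x = (\<lambda>_. 0)"
    proof (rule linear_eq_stdbasis)
      show "linear (\<lambda>_. 0 :: (real^8) \<times> (real^8))"
        by (simp add: linear_iff)
      show "act x b = 0" if "b \<in> Basis" for b
        using that zero by (auto simp: Basis_prod_def Basis_vec_def)
    qed (rule linear_act)
    then show "x = 0"
      by (intro act_faithful) simp
  qed
  then obtain L where L: "linear L" "L \<circ> Q = id"
    using linear_injective_left_inverse[OF lin] by blast
  have eq: "s g = L (\<chi> k. (kappa_plus (s g) *v axis k 1, 0), \<chi> k. (0, kappa_minus (s g) *v axis k 1))"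
    if "g \<in> carrier Spin8" for g
  proof -
    have "s g = L (Q (s g))"
      using L(2) by (simp add: fun_eq_iff)
    then show ?thesis
      using closed[OF that] by (simp add: Q_def kappa_plus_apply kappa_minus_apply)
  qed
  have "continuous_on (carrier Spin8)
      (\<lambda>g. L (\<chi> k. (kappa_plus (s g) *v axis k 1, 0), \<chi> k. (0, kappa_minus (s g) *v axis k 1)))"
    unfolding matrix_vector_mult_def
    by (rule linear_continuous_on_compose[OF _ L(1)])
      (intro continuous_intros plus minus)
  then show ?thesis
    using eq by (simp cong: continuous_on_cong)
qed

lemma continuous_kappa:
  "continuous_on (carrier Spin8) kappa_plus" "continuous_on (carrier Spin8) kappa_minus"
proof -
  have eq: "kappa_plus g = (\<chi> i j. fst (act g (axis j 1, 0)) $ i)"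
    "kappa_minus g = (\<chi> i j. snd (act g (0, axis j 1)) $ i)" if "g \<in> carrier Spin8" for g
    using that by (simp_all add: vec_eq_iff kappa_plus_apply kappa_minus_apply matrix_vector_mul_component
        inner_axis)
  have "continuous_on (carrier Spin8) (\<lambda>g. \<chi> i j. fst (act g (axis j 1, 0)) $ i)"
    "continuous_on (carrier Spin8) (\<lambda>g. \<chi> i j. snd (act g (0, axis j 1)) $ i)"
    by (intro continuous_intros linear_continuous_on_compose[OF continuous_on_id linear_act_left])+
  then show "continuous_on (carrier Spin8) kappa_plus" "continuous_on (carrier Spin8) kappa_minus"
    using eq by (simp_all cong: continuous_on_cong)
qed

text \<open>Continuity of \<open>lambda8\<close> is not visible from \<open>g x g\<^sup>-\<^sup>1\<close> until the inverse is known to be continuous.  Solving the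
triality relation at the spinor \<open>y\<close> with \<open>kappa_plus g y = 1\<close> expresses it through the half-spin representations,
which are linear in \<open>g\<close>.\<close>

lemma lambda8_by_kappa:
  assumes "g \<in> carrier Spin8"
  shows "lambda8 g *v x = oconj (kappa_minus g *v oct x (transpose (kappa_plus g) *v axis 1 1))"
proof -
  have "kappa_minus g *v oct x (transpose (kappa_plus g) *v axis 1 1) = oct (lambda8 g *v x) (axis 1 1)"
    unfolding triality[OF assms] orthogonal_matrix_cancel(1)[OF orthogonal_kappa(1)[OF assms]] ..
  then show ?thesis
    using oconj_oct[of "lambda8 g *v x" "axis 1 1"] by (simp add: oct_one)
qed

lemma continuous_lambda8: "continuous_on (carrier Spin8) lambda8"
proof -
  define F where "F g x = oconj (kappa_minus g *v oct x (transpose (kappa_plus g) *v axis 1 1))" for g x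
  have lin: "linear oconj" "linear (oct x)" for x
    by (auto intro!: linearI simp: oconj_linear oct_linear)
  have F: "continuous_on (carrier Spin8) (\<lambda>g. F g x)" for x
    unfolding F_def matrix_vector_mult_def transpose_def
    by (intro linear_continuous_on_compose[OF _ lin(1)] linear_continuous_on_compose[OF _ lin(2)]
        continuous_intros continuous_kappa)
  have "lambda8 g = (\<chi> i j. F g (axis j 1) $ i)" if "g \<in> carrier Spin8" for g
    unfolding F_def lambda8_by_kappa[OF that, symmetric]
    by (simp add: vec_eq_iff matrix_vector_mul_component inner_axis)
  moreover have "continuous_on (carrier Spin8) (\<lambda>g. \<chi> i j. F g (axis j 1) $ i)"
    by (intro continuous_intros F)
  ultimately show ?thesis
    by (simp cong: continuous_on_cong)
qed

lemma continuous_swap_aut: "continuous_on (carrier Spin8) swap_aut"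
proof (rule continuous_by_kappa)
  have "continuous_on (carrier Spin8) (\<lambda>g. conj_twist (kappa_minus g))"
    unfolding conj_twist_def matrix_def matrix_vector_mult_def
    by (intro linear_continuous_on_compose[of _ _ oconj] linearI continuous_intros continuous_kappa)
      (simp_all add: oconj_linear)
  then show "continuous_on (carrier Spin8) (\<lambda>g. kappa_minus (swap_aut g))"
    by (simp add: swap_aut cong: continuous_on_cong)
  show "continuous_on (carrier Spin8) (\<lambda>g. kappa_plus (swap_aut g))"
    using continuous_lambda8 by (simp add: swap_aut cong: continuous_on_cong)
qed (rule swap_aut)

lemma continuous_pin_aut: "continuous_on (carrier Spin8) pin_aut"
  by (rule continuous_by_kappa) (simp_all add: pin_aut continuous_kappa cong: continuous_on_cong)

theorem tau8_eq: "tau8 = swap_aut"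
  unfolding tau8_def
  by (rule spin_lift_eq) (simp_all add: swap_aut_hom continuous_swap_aut swap_aut, simp add: swap_aut_def)

theorem sigma8_eq: "sigma8 = compose (carrier Spin8) swap_aut pin_aut"
  unfolding sigma8_def
proof (rule spin_lift_eq)
  show "compose (carrier Spin8) swap_aut pin_aut \<in> hom Spin8 Spin8"
    using pin_aut_hom swap_aut_hom by (rule group.hom_compose[OF group_Spin8])
  have "continuous_on (carrier Spin8) (swap_aut \<circ> pin_aut)"
    by (intro continuous_on_compose continuous_pin_aut continuous_on_subset[OF continuous_swap_aut])
      (auto simp: pin_aut)
  then show "continuous_on (carrier Spin8) (compose (carrier Spin8) swap_aut pin_aut)"
    by (simp add: compose_def cong: continuous_on_cong)
qed (simp_all add: compose_def swap_aut pin_aut)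

section \<open>The symmetric group generated by the lifts\<close>

text \<open>The relations reduce every word in \<open>t\<close> and \<open>a\<close> to one of \<open>1\<close>, \<open>t\<close>, \<open>a\<close>, \<open>t a\<close>, \<open>a t\<close> and \<open>t a t\<close>.  The map
\<open>f\<close> sends a permutation to such a normal form, with the transposition of \<open>1\<close> and \<open>2\<close> going to \<open>t\<close> and that of \<open>2\<close> and
\<open>3\<close> to \<open>a\<close>.  If one of the last five words were trivial, the relations would force \<open>t = a\<close>; hence \<open>f\<close> is
injective.\<close>

lemma (in group) two_involutions_sym_group_3:
  assumes t: "t \<in> carrier G" "t \<otimes> t = \<one>" and a: "a \<in> carrier G" "a \<otimes> a = \<one>"
    and braid: "a \<otimes> (t \<otimes> a) = t \<otimes> (a \<otimes> t)" and "t \<noteq> a"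
  shows "subgroup_generated G {t \<otimes> a, t} \<cong> sym_group 3"
proof -
  have tt: "t \<otimes> (t \<otimes> x) = x" if "x \<in> carrier G" for x
    using that t by (metis m_assoc l_one)
  have aa: "a \<otimes> (a \<otimes> x) = x" if "x \<in> carrier G" for x
    using that a by (metis m_assoc l_one)
  have ata: "a \<otimes> (t \<otimes> (a \<otimes> x)) = t \<otimes> (a \<otimes> (t \<otimes> x))" if "x \<in> carrier G" for x
  proof -
    have "(a \<otimes> (t \<otimes> a)) \<otimes> x = (t \<otimes> (a \<otimes> t)) \<otimes> x"
      by (simp only: braid)
    then show ?thesis
      using that a t by (simp add: m_assoc)
  qed
  note word = m_assoc t a tt aa braid ata
  define f where "f p = (if p 1 = 1 then if p 2 = 2 then \<one> else a
    else if p 1 = 2 then if p 2 = 1 then t else t \<otimes> a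
    else if p 2 = 1 then a \<otimes> t else t \<otimes> (a \<otimes> t))" for p :: "nat \<Rightarrow> nat"
  have cases: "(p 1 = 1 \<and> p 2 = 2 \<and> p 3 = 3) \<or> (p 1 = 1 \<and> p 2 = 3 \<and> p 3 = 2) \<or>
      (p 1 = 2 \<and> p 2 = 1 \<and> p 3 = 3) \<or> (p 1 = 2 \<and> p 2 = 3 \<and> p 3 = 1) \<or>
      (p 1 = 3 \<and> p 2 = 1 \<and> p 3 = 2) \<or> (p 1 = 3 \<and> p 2 = 2 \<and> p 3 = 1)"
    if "p permutes {1..3}" for p :: "nat \<Rightarrow> nat"
  proof -
    have three: "{1..3::nat} = {1, 2, 3}"
      by auto
    have "p 1 \<in> {1, 2, 3}" "p 2 \<in> {1, 2, 3}" "p 3 \<in> {1, 2, 3}"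
      using permutes_in_image[OF that] unfolding three by simp_all
    moreover have "p 1 \<noteq> p 2" "p 1 \<noteq> p 3" "p 2 \<noteq> p 3"
      using permutes_inj[OF that] by (simp_all add: inj_eq)
    ultimately show ?thesis
      by (elim insertE emptyE) simp_all
  qed
  have closed: "f p \<in> carrier G" for p
    using t a by (simp add: f_def)
  have mult: "f (p \<circ> q) = f p \<otimes> f q" if "p permutes {1..3}" "q permutes {1..3}" for p q
    using cases[OF that(1)] cases[OF that(2)]
    by (elim disjE conjE; simp add: f_def word)
  have hom: "f \<in> hom (sym_group 3) G"
    by (rule homI) (simp_all add: closed sym_group_carrier sym_group_mult mult)
  interpret f: group_hom "sym_group 3" G f
    using hom sym_group_is_group by (simp add: group_hom_def group_hom_axioms_def group_axioms)
  have ne: "t \<noteq> \<one>" "a \<noteq> \<one>"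
    using \<open>t \<noteq> a\<close> braid t a by auto
  have "t \<otimes> a \<noteq> \<one>" "a \<otimes> t \<noteq> \<one>"
    using \<open>t \<noteq> a\<close> t a by (metis inv_equality inv_unique')+
  moreover have "t \<otimes> (a \<otimes> t) \<noteq> \<one>"
  proof
    assume "t \<otimes> (a \<otimes> t) = \<one>"
    then have "t \<otimes> (t \<otimes> (a \<otimes> t)) = t"
      using t by simp
    then have "a \<otimes> t = t"
      using t a by (simp add: tt)
    then show False
      using t a ne by simp
  qed
  ultimately have kernel: "p = id" if "p permutes {1..3}" "f p = \<one>" for p
  proof -
    have "p 1 = 1 \<and> p 2 = 2 \<and> p 3 = 3"
      using cases[OF that(1)] that(2) ne \<open>t \<otimes> a \<noteq> \<one>\<close> \<open>a \<otimes> t \<noteq> \<one>\<close> \<open>t \<otimes> (a \<otimes> t) \<noteq> \<one>\<close>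
      by (elim disjE conjE) (simp_all add: f_def)
    moreover have "p n = n" if "n \<notin> {1..3}" for n
      using \<open>p permutes {1..3}\<close> that by (rule permutes_not_in)
    moreover have "n \<in> {1..3} \<Longrightarrow> n = 1 \<or> n = 2 \<or> n = 3" for n :: nat
      by auto
    ultimately show ?thesis
      by (metis eq_id_iff)
  qed
  have inj: "inj_on f (carrier (sym_group 3))"
    using kernel by (auto simp: f.inj_on_one_iff sym_group_carrier sym_group_one)
  let ?H = "generate G {t \<otimes> a, t}"
  have image: "f ` carrier (sym_group 3) = ?H"
  proof
    have H: "subgroup ?H G"
      using t a by (intro generate_is_subgroup) auto
    have "t \<in> ?H" "t \<otimes> a \<in> ?H"
      by (auto intro: generate.incl)
    then have "t \<in> ?H" "a \<in> ?H"
      using subgroup.m_closed[OF H, of t "t \<otimes> a"] a tt by auto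
    then show "f ` carrier (sym_group 3) \<subseteq> ?H"
      using subgroup.m_closed[OF H] subgroup.one_closed[OF H] by (auto simp: f_def)
    have "Transposition.transpose 1 2 permutes {1..3::nat}"
      "Transposition.transpose 2 3 permutes {1..3::nat}"
      by (simp_all add: permutes_swap_id)
    moreover have "f (Transposition.transpose 1 2) = t" "f (Transposition.transpose 2 3) = a"
      by (simp_all add: f_def Transposition.transpose_def)
    ultimately have "t \<in> f ` carrier (sym_group 3)" "a \<in> f ` carrier (sym_group 3)"
      unfolding sym_group_carrier by (metis image_eqI sym_group_carrier)+
    then show "?H \<subseteq> f ` carrier (sym_group 3)"
      using f.img_is_subgroup by (intro generate_subgroup_incl) (auto intro: subgroup.m_closed)
  qed
  have "f \<in> iso (sym_group 3) (subgroup_generated G {t \<otimes> a, t})"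
    using hom inj image t a
    by (auto simp: iso_def bij_betw_def hom_def carrier_subgroup_generated subgroup_generated_def
        Int_absorb1)
  then show ?thesis
    using group.iso_sym[OF sym_group_is_group] by (auto simp: is_iso_def)
qed

lemma swap_aut_swap_aut: "g \<in> carrier Spin8 \<Longrightarrow> swap_aut (swap_aut g) = g"
  by (rule Spin_eqI) (simp_all add: swap_aut)

lemma pin_aut_pin_aut: "g \<in> carrier Spin8 \<Longrightarrow> pin_aut (pin_aut g) = g"
  by (rule Spin_eqI) (simp_all add: pin_aut)

lemma swap_pin_braid:
  "g \<in> carrier Spin8 \<Longrightarrow> pin_aut (swap_aut (pin_aut g)) = swap_aut (pin_aut (swap_aut g))"
  by (rule Spin_eqI) (simp_all add: pin_aut swap_aut)

lemma involution_in_AutoGroup: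
  assumes "f \<in> hom Spin8 Spin8" "f \<in> extensional (carrier Spin8)"
    "\<And>g. g \<in> carrier Spin8 \<Longrightarrow> f (f g) = g"
  shows "f \<in> carrier (AutoGroup Spin8)"
proof -
  have "bij_betw f (carrier Spin8) (carrier Spin8)"
    using assms by (intro bij_betw_byWitness[of _ f]) (auto simp: hom_def)
  then show ?thesis
    using assms by (simp add: AutoGroup_def auto_def Bij_def)
qed

lemma AutoGroup_mult:
  assumes "f \<in> carrier (AutoGroup Spin8)" "h \<in> carrier (AutoGroup Spin8)"
  shows "f \<otimes>\<^bsub>AutoGroup Spin8\<^esub> h = compose (carrier Spin8) f h"
  using assms by (simp add: AutoGroup_def BijGroup_def auto_def)

theorem triality_group: "subgroup_generated (AutoGroup Spin8) {sigma8, tau8} \<cong> sym_group 3"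
proof -
  let ?S = "carrier Spin8"
  have ext: "swap_aut \<in> extensional ?S" "pin_aut \<in> extensional ?S"
    by (simp_all add: swap_aut_def pin_aut_def)
  have mem: "swap_aut \<in> carrier (AutoGroup Spin8)" "pin_aut \<in> carrier (AutoGroup Spin8)"
    using ext swap_aut_hom pin_aut_hom
    by (auto intro!: involution_in_AutoGroup simp: swap_aut_swap_aut pin_aut_pin_aut)
  interpret A: group "AutoGroup Spin8"
    using group_Spin8 by (rule group.AutoGroup)
  have one: "\<one>\<^bsub>AutoGroup Spin8\<^esub> = (\<lambda>g\<in>?S. g)"
    by (simp add: AutoGroup_def BijGroup_def)
  have sigma: "sigma8 = swap_aut \<otimes>\<^bsub>AutoGroup Spin8\<^esub> pin_aut"
    by (simp only: AutoGroup_mult[OF mem] sigma8_eq)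
  have ne: "swap_aut \<noteq> pin_aut"
  proof
    assume eq: "swap_aut = pin_aut"
    have g: "- cl_one \<in> ?S"
      by (simp add: Spin_minus Spin_one)
    have "kappa_plus (- cl_one) = conj_twist (lambda8 (- cl_one))"
      using swap_aut(2)[OF g] pin_aut(2)[OF g] by (simp add: eq)
    then have "- kappa_plus cl_one = conj_twist (lambda8 cl_one)"
      by (simp add: Spin_minus_representations Spin_one)
    moreover have "lambda8 cl_one *v x = x" "kappa_plus cl_one *v x = x" for x
      using lambda8_unique[OF Spin_one, of x x] kappa_plus_apply[OF Spin_one, of x] by simp_all
    ultimately have neg: "- x = x" for x :: "real^8"
      by (metis conj_twist_apply matrix_vector_mult_minus oconj_oconj)
    have "(- axis 1 1 :: real^8) $ 1 = (axis 1 1 :: real^8) $ 1"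
      by (simp only: neg)
    then show False
      by (simp add: axis_def)
  qed
  have square: "swap_aut \<otimes>\<^bsub>AutoGroup Spin8\<^esub> swap_aut = \<one>\<^bsub>AutoGroup Spin8\<^esub>"
    "pin_aut \<otimes>\<^bsub>AutoGroup Spin8\<^esub> pin_aut = \<one>\<^bsub>AutoGroup Spin8\<^esub>"
    unfolding AutoGroup_mult[OF mem(1) mem(1)] AutoGroup_mult[OF mem(2) mem(2)] one compose_def
    by (simp_all add: swap_aut_swap_aut pin_aut_pin_aut cong: restrict_cong)
  have braid: "pin_aut \<otimes>\<^bsub>AutoGroup Spin8\<^esub> (swap_aut \<otimes>\<^bsub>AutoGroup Spin8\<^esub> pin_aut)
      = swap_aut \<otimes>\<^bsub>AutoGroup Spin8\<^esub> (pin_aut \<otimes>\<^bsub>AutoGroup Spin8\<^esub> swap_aut)"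
    unfolding AutoGroup_mult[OF mem(2) A.m_closed[OF mem]]
      AutoGroup_mult[OF mem(1) A.m_closed[OF mem(2) mem(1)]]
    unfolding AutoGroup_mult[OF mem] AutoGroup_mult[OF mem(2) mem(1)]
    by (simp add: compose_def swap_pin_braid cong: restrict_cong)
  have "subgroup_generated (AutoGroup Spin8) {swap_aut \<otimes>\<^bsub>AutoGroup Spin8\<^esub> pin_aut, swap_aut} \<cong> sym_group 3"
    using mem(1) square(1) mem(2) square(2) braid ne by (rule A.two_involutions_sym_group_3)
  then show ?thesis
    by (simp add: sigma tau8_eq)
qed

theorem corollary4p4:
  shows "subgroup_generated (AutoGroup Spin8) {sigma8, tau8} \<cong> sym_group 3 \<and>
    lambda8 \<in> hom Spin8 SO8 \<and> kappa_plus \<in> hom Spin8 SO8 \<and> kappa_minus \<in> hom Spin8 SO8 \<and>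
    (\<forall>g\<in>carrier Spin8. (lambda8 \<circ> sigma8) g = kappa_minus g) \<and>
    (\<forall>g\<in>carrier Spin8. (lambda8 \<circ> tau8) g = kappa_plus g) \<and>
    (\<forall>g\<in>carrier Spin8. (kappa_minus \<circ> (tau8 \<circ> sigma8)) g = kappa_plus g)"
  using triality_group lambda8_hom kappa_plus_hom kappa_minus_hom
  by (simp add: sigma8_eq tau8_eq compose_def swap_aut pin_aut)

end
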